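(* (Value Theorem) Let $G$ be a \textsc{flipping coins} position, and let $v_0$ be the value returned by the Algorithm described in the context when applied to $G$. Then $G=v_0$ as combinatorial games.
   Context: \textsc{Flipping coins}: a position is a finite string $d_1d_2\ldots d_n$ with each $d_i\in\{0,1\}$ (written left to right). Any $0$s after the last $1$ are deleted, so a position is either empty or ends in $1$. - A Left move chooses indices $i<j$ with $d_i=d_j=1$ and changes both to $0$. - A Right move chooses indices $k<\ell$ with $d_k=0$ and $d_\ell=1$, and changes $d_k$ to $1$ and $d_\ell$ to $0$. - After any move, all $0$s following the last $1$ are deleted. The game is played under normal play, and positions are regarded as short partizan games with the usual equality and order. Notation: juxtaposition denotes concatenation of strings, and $x^m$ denotes $m$ consecutive copies of the symbol $x$. Greek letters denote arbitrary, possibly empty, $0$-$1$ strings. The ordinal sum of games $G$ (base) and $H$ (exponent) is defined recursively by $G:H=\{G^{\mathcal L},\,G:H^{\mathcal L}\mid G^{\mathcal R},\,G:H^{\mathcal R}\}$, where $G^{\mathcal L}$ ranges over the Left options of $G$ and $H^{\mathcal L}$ over the Left options of $H$, and similarly for Right. A dyadic rational, such as $1/2^k$ or $-r$, stands for its canonical-form game. Algorithm. Input: a position $G$. Set $G_0=G$. 1. Set $i=0$. 2. Reductions (here $\alpha,\beta$ are strings, either possibly empty): (a) If $G_0=\alpha01^{3+j}\beta$ with $j\ge 1$, set $G_0=\alpha101^{j}\beta$. (b) If $G_0=\alpha01^{3}\beta$ and $\beta$ contains an even number of $1$s, set $G_0=\alpha10\beta$. (c) Repeat until neither (a) nor (b)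 applies, then go to Step 3. 3. If $G_i$ is $0^r1$ with $r\ge0$, or $G_i$ is $1^a0^{p_i}10^{q_i}1$ with $a\ge0$ and $p_i+q_i\ge0$, go to Step 5. Otherwise $G_i=\alpha01^a0^{p_i}10^{q_i}1$ with $p_i+q_i\ge1$, $a>0$ and some string $\alpha$; set $G_{i+1}=\alpha01^a$ and go to Step 4. 4. Set $i=i+1$ and go to Step 3. 5. If $G_i=0^r1$, set $v_i=-r$. If $G_i=1^a0^{p_i}10^{q_i}1$, set $v_i=\lfloor a/2\rfloor+\frac{1}{2^{2p_i+q_i}}$. 6. For $j$ from $i-1$ down to $0$, set $v_j=v_{j+1}:\frac{1}{2^{2p_j+q_j-1}}$ (ordinal sum). 7. Return $v_0$. *)

theory Defs
  imports Complex_Main "HOL-Library.FSet"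
begin

section \<open>Short partizan games\<close>

datatype game = Game (left_opts: "game fset") (right_opts: "game fset")

lemma size_fset_mem: "x |\<in>| X \<Longrightarrow> size x < size_fset size X"
proof -
  assume "x |\<in>| X"
  then have "Suc (size x) \<le> (\<Sum>y \<in> fset X. Suc (size y))"
    by (intro member_le_sum) auto
  then show ?thesis
    by simp
qed

lemma size_left_opts: "x |\<in>| left_opts G \<Longrightarrow> size x < size G"
  by (cases G) (auto dest: size_fset_mem)

lemma size_right_opts: "x |\<in>| right_opts G \<Longrightarrow> size x < size G"
  by (cases G) (auto dest: size_fset_mem)

text \<open>Conway's order: \<open>G \<le> H\<close> iff no left option \<open>G\<^sup>L\<close> satisfies \<open>H \<le> G\<^sup>L\<close> and
  no right option \<open>H\<^sup>R\<close> satisfies \<open>H\<^sup>R \<le> G\<close>.  Equality of games is \<open>\<approx>\<close>; the HOL equality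
  on type \<^typ>\<open>game\<close> is identity of forms.\<close>

function game_le :: "game \<Rightarrow> game \<Rightarrow> bool" (infix "\<lesssim>" 50) where
  "game_le G H \<longleftrightarrow>
     (\<forall>X \<in> fset (left_opts G). \<not> game_le H X) \<and> (\<forall>Y \<in> fset (right_opts H). \<not> game_le Y G)"
  by pat_completeness auto
termination
  by (relation "measure (\<lambda>(G, H). size G + size H)")
     (auto dest: size_left_opts size_right_opts)

declare game_le.simps [simp del]

definition game_eq :: "game \<Rightarrow> game \<Rightarrow> bool" (infix "\<approx>" 50) where
  "G \<approx> H \<longleftrightarrow> G \<lesssim> H \<and> H \<lesssim> G"

text \<open>The ordinal sum \<open>G : H\<close>, which depends on the form of the base \<open>G\<close>.\<close>

primrec ordinal_sum :: "game \<Rightarrow> game \<Rightarrow> game" where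
  "ordinal_sum G (Game L R) =
     Game (left_opts G |\<union>| ordinal_sum G |`| L) (right_opts G |\<union>| ordinal_sum G |`| R)"

primrec nat_game :: "nat \<Rightarrow> game" where
  "nat_game 0 = Game {||} {||}"
| "nat_game (Suc n) = Game {|nat_game n|} {||}"

primrec neg_nat_game :: "nat \<Rightarrow> game" where
  "neg_nat_game 0 = Game {||} {||}"
| "neg_nat_game (Suc n) = Game {||} {|neg_nat_game n|}"

text \<open>\<open>dyadic m k\<close> is the canonical form of the number \<open>m / 2\<^sup>k\<close>; for odd \<open>m\<close> and \<open>k \<ge> 1\<close> this
  is \<open>{(m - 1) / 2\<^sup>k | (m + 1) / 2\<^sup>k}\<close>, whose options have even numerators.\<close>

primrec dyadic :: "int \<Rightarrow> nat \<Rightarrow> game" where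
  "dyadic m 0 = (if m \<ge> 0 then nat_game (nat m) else neg_nat_game (nat (- m)))"
| "dyadic m (Suc k) =
     (if even m then dyadic (m div 2) k
      else Game {|dyadic ((m - 1) div 2) k|} {|dyadic ((m + 1) div 2) k|})"


section \<open>Flipping coins\<close>

text \<open>Strings over \<open>{0, 1}\<close> are Boolean lists.\<close>

abbreviation (input) Zero :: bool where "Zero \<equiv> False"
abbreviation (input) One :: bool where "One \<equiv> True"

abbreviation (input) zeros :: "nat \<Rightarrow> bool list" where "zeros n \<equiv> replicate n Zero"
abbreviation (input) ones :: "nat \<Rightarrow> bool list" where "ones n \<equiv> replicate n One"

definition position :: "bool list \<Rightarrow> bool" where
  "position s \<longleftrightarrow> s = [] \<or> last s = One"

definition trim :: "bool list \<Rightarrow> bool list" where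
  "trim s = rev (dropWhile (\<lambda>d. d = Zero) (rev s))"

definition left_moves :: "bool list \<Rightarrow> bool list fset" where
  "left_moves s = fset_of_list
     [trim (s[i := Zero, j := Zero]). j \<leftarrow> [0..<length s], i \<leftarrow> [0..<j], s ! i = One \<and> s ! j = One]"

definition right_moves :: "bool list \<Rightarrow> bool list fset" where
  "right_moves s = fset_of_list
     [trim (s[k := One, l := Zero]). l \<leftarrow> [0..<length s], k \<leftarrow> [0..<l], s ! k = Zero \<and> s ! l = One]"

text \<open>Termination of play: every move decreases the sum of the (1-based) indices of the \<open>1\<close>s.\<close>

definition weight :: "bool list \<Rightarrow> nat" where
  "weight s = (\<Sum>i<length s. if s ! i then Suc i else 0)"

lemma weight_snoc: "weight (s @ [d]) = weight s + (if d then Suc (length s) else 0)"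
  by (simp add: weight_def nth_append)

lemma weight_trim: "weight (trim s) = weight s"
  by (induction s rule: rev_induct) (auto simp: trim_def weight_snoc)

lemma weight_off:
  assumes "j < length s" "s ! j"
  shows "weight s = weight (s[j := Zero]) + Suc j"
proof -
  have "(\<Sum>i\<in>{..<length s} - {j}. if s[j := Zero] ! i then Suc i else 0) =
      (\<Sum>i\<in>{..<length s} - {j}. if s ! i then Suc i else 0)"
    by (rule sum.cong) auto
  then show ?thesis
    using assms by (simp add: weight_def sum.remove[of _ j])
qed

lemma weight_on:
  assumes "k < length s" "\<not> s ! k"
  shows "weight (s[k := One]) = weight s + Suc k"
  using weight_off[of k "s[k := One]"] assms list_update_id[of s k] by simp

lemma weight_left_moves: "t |\<in>| left_moves s \<Longrightarrow> weight t < weight s"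
proof -
  assume "t |\<in>| left_moves s"
  then obtain i j where *: "i < j" "j < length s" "s ! i" "s ! j"
    and t: "t = trim (s[i := Zero, j := Zero])"
    by (auto simp: left_moves_def fset_of_list_elem split: if_splits)
  show ?thesis
    using weight_off[of i s] weight_off[of j "s[i := Zero]"] * by (simp add: t weight_trim)
qed

lemma weight_right_moves: "t |\<in>| right_moves s \<Longrightarrow> weight t < weight s"
proof -
  assume "t |\<in>| right_moves s"
  then obtain k l where *: "k < l" "l < length s" "\<not> s ! k" "s ! l"
    and t: "t = trim (s[k := One, l := Zero])"
    by (auto simp: right_moves_def fset_of_list_elem split: if_splits)
  show ?thesis
    using weight_on[of k s] weight_off[of l "s[k := One]"] * by (simp add: t weight_trim)
qed

function coins_game :: "bool list \<Rightarrow> game" where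
  "coins_game s = Game (coins_game |`| left_moves s) (coins_game |`| right_moves s)"
  by pat_completeness auto
termination
  by (relation "measure weight") (auto dest: weight_left_moves weight_right_moves)

declare coins_game.simps [simp del]


section \<open>The algorithm\<close>

text \<open>In (b), \<open>\<alpha>10\<beta>\<close> is read as a position: its trailing zero is deleted if \<open>\<beta>\<close> is empty.  In (a)
  nothing needs to be deleted because \<open>j \<ge> 1\<close>.\<close>

inductive reduct :: "bool list \<Rightarrow> bool list \<Rightarrow> bool" where
  reduct_a: "j \<ge> 1 \<Longrightarrow> reduct (\<alpha> @ [Zero] @ ones (3 + j) @ \<beta>) (\<alpha> @ [One, Zero] @ ones j @ \<beta>)"
| reduct_b: "even (count_list \<beta> One) \<Longrightarrow>
    reduct (\<alpha> @ [Zero] @ ones 3 @ \<beta>) (trim (\<alpha> @ [One, Zero] @ \<beta>))"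

definition reduced :: "bool list \<Rightarrow> bool" where
  "reduced s \<longleftrightarrow> (\<nexists>t. reduct s t)"

definition base_string :: "bool list \<Rightarrow> bool" where
  "base_string s \<longleftrightarrow>
     (\<exists>r. s = zeros r @ [One]) \<or> (\<exists>a p q. s = ones a @ zeros p @ [One] @ zeros q @ [One])"

text \<open>\<open>evaluates s v\<close>: Steps 3--6 entered with \<open>G\<^sub>i = s\<close> yield \<open>v\<^sub>i = v\<close>.  The loop counting \<open>i\<close> up in
  Steps 3 and 4 and the loop counting \<open>j\<close> down in Step 6 become the recursion of the last rule, whose
  first \<open>s\<close> is \<open>G\<^sub>i\<close> and whose \<open>v\<close> is \<open>v\<^bsub>i+1\<^esub>\<close>.  In the second rule,
  \<open>\<lfloor>a / 2\<rfloor> + 1 / 2\<^sup>k = (\<lfloor>a / 2\<rfloor> * 2\<^sup>k + 1) / 2\<^sup>k\<close> for \<open>k = 2 p + q\<close>.\<close>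

inductive evaluates :: "bool list \<Rightarrow> game \<Rightarrow> bool" where
  evaluates_single: "evaluates (zeros r @ [One]) (dyadic (- int r) 0)"
| evaluates_base:
    "evaluates (ones a @ zeros p @ [One] @ zeros q @ [One])
       (dyadic (int (a div 2) * 2 ^ (2 * p + q) + 1) (2 * p + q))"
| evaluates_step:
    "s = \<alpha> @ [Zero] @ ones a @ zeros p @ [One] @ zeros q @ [One] \<Longrightarrow> \<not> base_string s \<Longrightarrow>
     p + q \<ge> 1 \<Longrightarrow> a > 0 \<Longrightarrow> evaluates (\<alpha> @ [Zero] @ ones a) v \<Longrightarrow>
     evaluates s (ordinal_sum v (dyadic 1 (2 * p + q - 1)))"

text \<open>The reductions may be applied in any order, so the output is a relation.  On the empty
  position, to which no case of Step 3 applies, the algorithm returns nothing.\<close>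

definition algorithm_returns :: "bool list \<Rightarrow> game \<Rightarrow> bool" where
  "algorithm_returns G v \<longleftrightarrow> (\<exists>G\<^sub>0. reduct\<^sup>*\<^sup>* G G\<^sub>0 \<and> reduced G\<^sub>0 \<and> evaluates G\<^sub>0 v)"

end

theory Submission
  imports Defs
begin

text \<open>All positions are numbers, because a Left move and a Right move either commute or lead to
  positions connected by a Left move.  Hence every move is a loss for the player who makes it, and
  options can be compared by exhibiting moves between them.  It follows that Left should take the two
  rightmost coins, and that Right should replace the rightmost \<open>01\<close> by \<open>10\<close>, so a position is
  determined by one Left and one Right option.  These agree, by induction, on the two sides of a
  reduction.  For a position \<open>\<alpha>01\<^sup>a0\<^sup>p10\<^sup>q1\<close> the Left option is \<open>\<alpha>01\<^sup>a\<close> and the Right option has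
  \<open>2p + q\<close> decreased by 1; this is the recursion of the ordinal sum with \<open>1 / 2\<^bsup>2p+q-1\<^esup>\<close>.  It starts at
  \<open>2p + q = 1\<close>, where the Right option \<open>\<alpha>01\<^bsup>a+2\<^esup>\<close> reduces to the Right option \<open>\<alpha>101\<^bsup>a-1\<^esup>\<close> of \<open>\<alpha>01\<^sup>a\<close>.\<close>

section \<open>Order and equality of games\<close>

lemma game_leI:
  assumes "\<And>X. X |\<in>| left_opts G \<Longrightarrow> \<not> H \<lesssim> X"
    and "\<And>Y. Y |\<in>| right_opts H \<Longrightarrow> \<not> Y \<lesssim> G"
  shows "G \<lesssim> H"
  by (subst game_le.simps) (use assms in blast)

lemma left_opt_not_ge: "G \<lesssim> H \<Longrightarrow> X |\<in>| left_opts G \<Longrightarrow> \<not> H \<lesssim> X"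
  by (subst (asm) game_le.simps) blast

lemma right_opt_not_le: "G \<lesssim> H \<Longrightarrow> Y |\<in>| right_opts H \<Longrightarrow> \<not> Y \<lesssim> G"
  by (subst (asm) game_le.simps) blast

lemma game_le_refl [simp]: "G \<lesssim> G"
proof (induction "size G" arbitrary: G rule: less_induct)
  case less
  show ?case
  proof (rule game_leI)
    fix X assume X: "X |\<in>| left_opts G"
    then have "X \<lesssim> X" by (intro less size_left_opts)
    then show "\<not> G \<lesssim> X" using X left_opt_not_ge by blast
  next
    fix Y assume Y: "Y |\<in>| right_opts G"
    then have "Y \<lesssim> Y" by (intro less size_right_opts)
    then show "\<not> Y \<lesssim> G" using Y right_opt_not_le by blast
  qed
qed

lemma game_le_trans [trans]: "G \<lesssim> H \<Longrightarrow> H \<lesssim> K \<Longrightarrow> G \<lesssim> K"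
proof (induction "size G + size H + size K" arbitrary: G H K rule: less_induct)
  case less
  show ?case
  proof (rule game_leI)
    fix X assume X: "X |\<in>| left_opts G"
    then show "\<not> K \<lesssim> X"
      using less.hyps[of H K X] less.prems left_opt_not_ge size_left_opts[OF X] by auto
  next
    fix Y assume Y: "Y |\<in>| right_opts K"
    then show "\<not> Y \<lesssim> G"
      using less.hyps[of Y G H] less.prems right_opt_not_le size_right_opts[OF Y] by auto
  qed
qed

lemma game_eq_refl [simp]: "G \<approx> G"
  by (simp add: game_eq_def)

lemma game_eq_trans [trans]: "G \<approx> H \<Longrightarrow> H \<approx> K \<Longrightarrow> G \<approx> K"
  unfolding game_eq_def using game_le_trans by blast

section \<open>Options of a position and trailing zeros\<close>

lemma left_moves_iff: "t |\<in>| left_moves s \<longleftrightarrow>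
    (\<exists>i j. i < j \<and> j < length s \<and> s ! i \<and> s ! j \<and> t = trim (s[i := Zero, j := Zero]))"
  by (auto simp: left_moves_def fset_of_list_elem Bex_def)

lemma right_moves_iff: "t |\<in>| right_moves s \<longleftrightarrow>
    (\<exists>k l. k < l \<and> l < length s \<and> \<not> s ! k \<and> s ! l \<and> t = trim (s[k := One, l := Zero]))"
  by (auto simp: right_moves_def fset_of_list_elem Bex_def)

lemma trim_snoc_Zero [simp]: "trim (s @ [Zero]) = trim s"
  by (simp add: trim_def)

text \<open>A trailing zero takes part in no move: Left flips only ones, and Right flips a zero only
  together with a 1 to its right. This lets everything below ignore \<open>trim\<close> and work
  with arbitrary strings.\<close>

lemma coins_game_snoc_Zero [simp]: "coins_game (s @ [Zero]) = coins_game s"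
proof -
  have "left_moves (s @ [Zero]) = left_moves s"
  proof (rule fset_eqI)
    fix t
    have "i < j \<and> j < length (s @ [Zero]) \<and> (s @ [Zero]) ! i \<and> (s @ [Zero]) ! j \<and>
          t = trim ((s @ [Zero])[i := Zero, j := Zero]) \<longleftrightarrow>
        i < j \<and> j < length s \<and> s ! i \<and> s ! j \<and> t = trim (s[i := Zero, j := Zero])" for i j
      by (cases "j < length s") (auto simp: nth_append list_update_append split: if_splits)
    then show "t |\<in>| left_moves (s @ [Zero]) \<longleftrightarrow> t |\<in>| left_moves s"
      by (simp only: left_moves_iff)
  qed
  moreover have "right_moves (s @ [Zero]) = right_moves s"
  proof (rule fset_eqI)
    fix t
    have "k < l \<and> l < length (s @ [Zero]) \<and> \<not> (s @ [Zero]) ! k \<and> (s @ [Zero]) ! l \<and>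
          t = trim ((s @ [Zero])[k := One, l := Zero]) \<longleftrightarrow>
        k < l \<and> l < length s \<and> \<not> s ! k \<and> s ! l \<and> t = trim (s[k := One, l := Zero])" for k l
      by (cases "l < length s") (auto simp: nth_append list_update_append split: if_splits)
    then show "t |\<in>| right_moves (s @ [Zero]) \<longleftrightarrow> t |\<in>| right_moves s"
      by (simp only: right_moves_iff)
  qed
  ultimately show ?thesis
    by (metis coins_game.simps)
qed

lemma coins_game_zeros [simp]: "coins_game (s @ zeros n) = coins_game s"
  by (induction n arbitrary: s) (simp_all flip: replicate_append_same append_assoc)

lemma trim_zeros: obtains n where "s = trim s @ zeros n"
proof -
  have "\<exists>n. s = trim s @ zeros n"
  proof (induction s rule: rev_induct)
    case (snoc d s)
    then obtain n where n: "s = trim s @ zeros n" by blast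
    show ?case
    proof (cases d)
      case True
      then show ?thesis by (auto simp: trim_def intro: exI[of _ 0])
    next
      case False
      then show ?thesis using n
        by (auto simp: replicate_append_same intro!: exI[of _ "Suc n"])
          (metis append.assoc replicate_append_same)
    qed
  qed (simp add: trim_def)
  then show ?thesis using that by blast
qed

lemma coins_game_trim [simp]: "coins_game (trim s) = coins_game s"
  by (metis coins_game_zeros trim_zeros)

lemma left_opts_coins_iff: "X |\<in>| left_opts (coins_game s) \<longleftrightarrow>
    (\<exists>i j. i < j \<and> j < length s \<and> s ! i \<and> s ! j \<and> X = coins_game (s[i := Zero, j := Zero]))"
proof -
  have "X |\<in>| left_opts (coins_game s) \<longleftrightarrow> (\<exists>t. t |\<in>| left_moves s \<and> X = coins_game t)"
    by (subst coins_game.simps) auto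
  then show ?thesis
    unfolding left_moves_iff by (metis coins_game_trim)
qed

lemma right_opts_coins_iff: "X |\<in>| right_opts (coins_game s) \<longleftrightarrow>
    (\<exists>k l. k < l \<and> l < length s \<and> \<not> s ! k \<and> s ! l \<and> X = coins_game (s[k := One, l := Zero]))"
proof -
  have "X |\<in>| right_opts (coins_game s) \<longleftrightarrow> (\<exists>t. t |\<in>| right_moves s \<and> X = coins_game t)"
    by (subst coins_game.simps) auto
  then show ?thesis
    unfolding right_moves_iff by (metis coins_game_trim)
qed

section \<open>Strict comparison of a position with its options\<close>

definition game_less :: "game \<Rightarrow> game \<Rightarrow> bool" (infix "\<prec>" 50) where
  "G \<prec> H \<longleftrightarrow> G \<lesssim> H \<and> \<not> H \<lesssim> G"

lemma game_less_imp_le: "G \<prec> H \<Longrightarrow> G \<lesssim> H"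
  by (simp add: game_less_def)

lemma game_less_trans [trans]: "G \<prec> H \<Longrightarrow> H \<prec> K \<Longrightarrow> G \<prec> K"
  unfolding game_less_def using game_le_trans by blast

lemma game_less_le_trans [trans]: "G \<prec> H \<Longrightarrow> H \<lesssim> K \<Longrightarrow> G \<prec> K"
  unfolding game_less_def using game_le_trans by blast

lemma game_le_less_trans [trans]: "G \<lesssim> H \<Longrightarrow> H \<prec> K \<Longrightarrow> G \<prec> K"
  unfolding game_less_def using game_le_trans by blast

abbreviation coins_le (infix "\<sqsubseteq>" 50) where "s \<sqsubseteq> t \<equiv> coins_game s \<lesssim> coins_game t"
abbreviation coins_less (infix "\<sqsubset>" 50) where "s \<sqsubset> t \<equiv> coins_game s \<prec> coins_game t"

lemma weight_left_update:
  assumes "i < j" "j < length s" "s ! i" "s ! j"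
  shows "weight (s[i := Zero, j := Zero]) < weight s"
  using weight_left_moves[of "trim (s[i := Zero, j := Zero])" s] assms
  by (auto simp: left_moves_iff weight_trim)

lemma weight_right_update:
  assumes "k < l" "l < length s" "\<not> s ! k" "s ! l"
  shows "weight (s[k := One, l := Zero]) < weight s"
  using weight_right_moves[of "trim (s[k := One, l := Zero])" s] assms
  by (auto simp: right_moves_iff weight_trim)

text \<open>A Left option \<open>l\<close> and a Right option \<open>r\<close> satisfy \<open>l < r\<close>: the moves either commute, so that
  \<open>l < l\<^sup>R = r\<^sup>L < r\<close>, or involve a common coin, and then \<open>l\<close> is a Left option of \<open>r\<close>.\<close>

lemma coins_le_opts:
  "(\<forall>X. X |\<in>| left_opts (coins_game s) \<longrightarrow> X \<lesssim> coins_game s) \<and>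
   (\<forall>Y. Y |\<in>| right_opts (coins_game s) \<longrightarrow> coins_game s \<lesssim> Y)"
proof (induction "weight s" arbitrary: s rule: less_induct)
  case less
  have IHl: "coins_game (t[i := Zero, j := Zero]) \<lesssim> coins_game t"
    if "i < j" "j < length t" "t ! i" "t ! j" "weight t < weight s" for t i j
    using less[of t] that
    by (auto simp: left_opts_coins_iff)
  have IHr: "coins_game t \<lesssim> coins_game (t[k := One, l := Zero])"
    if "k < l" "l < length t" "\<not> t ! k" "t ! l" "weight t < weight s" for t k l
    using less[of t] that
    by (auto simp: right_opts_coins_iff)
  have left_not_ge: "\<not> coins_game t \<lesssim> coins_game (t[i := Zero, j := Zero])"
    if "i < j" "j < length t" "t ! i" "t ! j" for t i j
    using left_opt_not_ge[OF game_le_refl, of "coins_game (t[i := Zero, j := Zero])" "coins_game t"] that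
    by (auto simp: left_opts_coins_iff)
  have cross: "\<not> coins_game (s[k := One, l := Zero]) \<lesssim> coins_game (s[i := Zero, j := Zero])"
    if L: "i < j" "j < length s" "s ! i" "s ! j" and R: "k < l" "l < length s" "\<not> s ! k" "s ! l" for i j k l
  proof -
    let ?lo = "s[i := Zero, j := Zero]" and ?ro = "s[k := One, l := Zero]"
    have ne: "k \<noteq> i" "k \<noteq> j" using L R by auto
    consider "l \<noteq> i" "l \<noteq> j" | "l = i" | "l = j" by blast
    then show ?thesis
    proof cases
      case 1
      have "?ro[i := Zero, j := Zero] = ?lo[k := One, l := Zero]"
        using ne 1 L R by (metis list_update_swap)
      moreover have "coins_game ?lo \<lesssim> coins_game (?lo[k := One, l := Zero])"
        using ne 1 L R by (intro IHr weight_left_update) auto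
      moreover have "\<not> coins_game ?ro \<lesssim> coins_game (?ro[i := Zero, j := Zero])"
        using ne 1 L R by (intro left_not_ge) auto
      ultimately show ?thesis
        using game_le_trans by metis
    next
      case 2
      have "?ro[k := Zero, j := Zero] = ?lo"
        using ne 2 L R by (auto simp: list_eq_iff_nth_eq nth_list_update)
      moreover have "\<not> coins_game ?ro \<lesssim> coins_game (?ro[k := Zero, j := Zero])"
        using ne 2 L R by (intro left_not_ge) auto
      ultimately show ?thesis by simp
    next
      case 3
      \<comment> \<open>The coin that Right took from \<open>l = j\<close> stands at
        \<open>k\<close>, so Left answers by taking \<open>i\<close> and \<open>k\<close>. Their
        order is not known, hence the two forms and the case split.\<close>
      have upd: "?ro[k := Zero, i := Zero] = ?lo" "?ro[i := Zero, k := Zero] = ?lo"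
        using ne 3 L R by (auto simp: list_eq_iff_nth_eq nth_list_update)
      show ?thesis
      proof (cases "i < k")
        case True
        then show ?thesis using left_not_ge[of i k ?ro] upd ne 3 L R by auto
      next
        case False
        then show ?thesis using left_not_ge[of k i ?ro] upd ne 3 L R by auto
      qed
    qed
  qed
  have "X \<lesssim> coins_game s" if "X |\<in>| left_opts (coins_game s)" for X
  proof -
    from that obtain i j where L: "i < j" "j < length s" "s ! i" "s ! j"
      and X: "X = coins_game (s[i := Zero, j := Zero])"
      by (auto simp: left_opts_coins_iff)
    show "X \<lesssim> coins_game s"
    proof (rule game_leI)
      \<comment> \<open>By induction \<open>Z \<lesssim> X\<close>, so
        \<open>coins_game s \<lesssim> Z\<close> would place \<open>coins_game s\<close> below its
        own Left option \<open>X\<close>.\<close>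
      fix Z assume "Z |\<in>| left_opts X"
      then have "Z \<lesssim> X"
        using less[of "s[i := Zero, j := Zero]"] X weight_left_update[OF L] by blast
      then show "\<not> coins_game s \<lesssim> Z"
        using left_not_ge[OF L] game_le_trans X by blast
    next
      fix Y assume "Y |\<in>| right_opts (coins_game s)"
      then show "\<not> Y \<lesssim> X"
        using cross[OF L] X by (auto simp: right_opts_coins_iff)
    qed
  qed
  moreover have "coins_game s \<lesssim> Y" if Y0: "Y |\<in>| right_opts (coins_game s)" for Y
  proof -
    from Y0 obtain k l where R: "k < l" "l < length s" "\<not> s ! k" "s ! l"
      and Y: "Y = coins_game (s[k := One, l := Zero])"
      by (auto simp: right_opts_coins_iff)
    show "coins_game s \<lesssim> Y"
    proof (rule game_leI)
      fix Z assume "Z |\<in>| right_opts Y"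
      then have "Y \<lesssim> Z"
        using less[of "s[k := One, l := Zero]"] Y weight_right_update[OF R] by blast
      then show "\<not> Z \<lesssim> coins_game s"
        using right_opt_not_le[OF game_le_refl Y0] game_le_trans by blast
    next
      fix X assume "X |\<in>| left_opts (coins_game s)"
      then show "\<not> Y \<lesssim> X"
        using cross[OF _ _ _ _ R] Y by (auto simp: left_opts_coins_iff)
    qed
  qed
  ultimately show ?case by blast
qed

lemma left_opt_less: "X |\<in>| left_opts (coins_game s) \<Longrightarrow> X \<prec> coins_game s"
  unfolding game_less_def using coins_le_opts left_opt_not_ge[OF game_le_refl] by blast

lemma right_opt_greater: "Y |\<in>| right_opts (coins_game s) \<Longrightarrow> coins_game s \<prec> Y"
  unfolding game_less_def using coins_le_opts right_opt_not_le[OF game_le_refl] by blast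

section \<open>Moves as splittings of the string\<close>

lemma left_update_mem:
  "i < j \<Longrightarrow> j < length s \<Longrightarrow> s ! i \<Longrightarrow> s ! j \<Longrightarrow>
    coins_game (s[i := Zero, j := Zero]) |\<in>| left_opts (coins_game s)"
  by (auto simp: left_opts_coins_iff)

lemma right_update_mem:
  "k < l \<Longrightarrow> l < length s \<Longrightarrow> \<not> s ! k \<Longrightarrow> s ! l \<Longrightarrow>
    coins_game (s[k := One, l := Zero]) |\<in>| right_opts (coins_game s)"
  by (auto simp: right_opts_coins_iff)

text \<open>Cutting the string at the two coins concerned replaces index arithmetic by matching on
  appends; most later comparisons name a move through \<open>\<alpha>\<close>,
  \<open>\<beta>\<close> and \<open>\<gamma>\<close>.\<close>

lemma left_move_mem:
  "coins_game (\<alpha> @ Zero # \<beta> @ Zero # \<gamma>) |\<in>| left_opts (coins_game (\<alpha> @ One # \<beta> @ One # \<gamma>))"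
  using left_update_mem[of "length \<alpha>" "length \<alpha> + Suc (length \<beta>)" "\<alpha> @ One # \<beta> @ One # \<gamma>"]
  by (simp add: nth_append list_update_append)

lemma right_move_mem:
  "coins_game (\<alpha> @ One # \<beta> @ Zero # \<gamma>) |\<in>| right_opts (coins_game (\<alpha> @ Zero # \<beta> @ One # \<gamma>))"
  using right_update_mem[of "length \<alpha>" "length \<alpha> + Suc (length \<beta>)" "\<alpha> @ Zero # \<beta> @ One # \<gamma>"]
  by (simp add: nth_append list_update_append)

lemmas left_move_less = left_opt_less[OF left_move_mem]
lemmas right_move_greater = right_opt_greater[OF right_move_mem]

lemma right_opts_coinsE:
  assumes "Y |\<in>| right_opts (coins_game s)"
  obtains \<alpha> \<beta> \<gamma> where "s = \<alpha> @ Zero # \<beta> @ One # \<gamma>" "Y = coins_game (\<alpha> @ One # \<beta> @ Zero # \<gamma>)"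
proof -
  obtain k l where R: "k < l" "l < length s" "\<not> s ! k" "s ! l"
    and Y: "Y = coins_game (s[k := One, l := Zero])"
    using assms by (auto simp: right_opts_coins_iff)
  define \<alpha> \<beta> \<gamma> where "\<alpha> = take k s" and "\<beta> = drop (Suc k) (take l s)" and "\<gamma> = drop (Suc l) s"
  have k: "take l s = \<alpha> @ Zero # \<beta>"
    using id_take_nth_drop[of k "take l s"] R by (simp add: \<alpha>_def \<beta>_def min_def)
  have s: "s = \<alpha> @ Zero # \<beta> @ One # \<gamma>"
    using id_take_nth_drop[of l s] R k by (simp add: \<gamma>_def)
  have len: "length \<alpha> = k" "l = k + Suc (length \<beta>)"
    using R by (auto simp: \<alpha>_def \<beta>_def)
  have "s[k := One, l := Zero] = \<alpha> @ One # \<beta> @ Zero # \<gamma>"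
    by (subst s) (simp add: len list_update_append)
  with Y have "Y = coins_game (\<alpha> @ One # \<beta> @ Zero # \<gamma>)" by simp
  with s show ?thesis by (rule that)
qed

section \<open>Best options of Left and Right\<close>

lemma zeros_or_last_One:
  obtains m where "s = zeros m" | t m where "s = t @ One # zeros m"
proof (cases "One \<in> set s")
  case True
  then obtain t u where "s = t @ One # u" "One \<notin> set u"
    by (meson split_list_last)
  then show ?thesis
    using that(2) replicate_length_same[of u Zero] by metis
next
  case False
  then show ?thesis
    using that(1) replicate_length_same[of s Zero] by metis
qed

text \<open>Simplification moves the last symbols before a block of zeros into conses, where
  \<open>coins_game_zeros\<close> does not match; these are the shapes that then occur.\<close>

lemma coins_game_zeros_Cons [simp]:
  "coins_game (s @ Zero # zeros n) = coins_game s"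
  "coins_game (s @ a # zeros n) = coins_game (s @ [a])"
  "coins_game (s @ a # b # zeros n) = coins_game (s @ [a, b])"
  using coins_game_zeros[of s "Suc n"] coins_game_zeros[of "s @ [a]" n]
    coins_game_zeros[of "s @ [a, b]" n] by simp_all

lemma right_update_le:
  "k < l \<Longrightarrow> l < length s \<Longrightarrow> \<not> s ! k \<Longrightarrow> s ! l \<Longrightarrow> s \<sqsubseteq> s[k := One, l := Zero]"
  using right_opt_greater[OF right_update_mem] game_less_imp_le by blast

text \<open>Right moves turn any other Left option into the one that takes the two rightmost coins.\<close>

lemma last_two_best:
  assumes "i' < j'" "j' < length s" "s ! i'" "s ! j'"
    and last: "\<And>x. x < length s \<Longrightarrow> s ! x \<Longrightarrow> x \<le> i' \<or> x = j'"
    and "i < j" "j < length s" "s ! i" "s ! j"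
  shows "s[i := Zero, j := Zero] \<sqsubseteq> s[i' := Zero, j' := Zero]"
proof -
  let ?u = "s[i := Zero, j := Zero]" and ?w = "s[i' := Zero, j' := Zero]"
  have "i \<le> i' \<or> i = j'" "j \<le> i' \<or> j = j'"
    using last assms(6-9) less_trans by blast+
  then consider "j = j'" "i = i'" | "j = j'" "i < i'" | "j = i'" | "j < i'"
    using assms(1,6) by linarith
  then show ?thesis
  proof cases
    case 1
    then show ?thesis by simp
  next
    case 2
    then have "?u[i := One, i' := Zero] = ?w"
      using assms by (auto simp: list_eq_iff_nth_eq nth_list_update)
    moreover have "?u \<sqsubseteq> ?u[i := One, i' := Zero]"
      using 2 assms by (intro right_update_le) auto
    ultimately show ?thesis by simp
  next
    case 3
    then have "?u[i := One, j' := Zero] = ?w"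
      using assms by (auto simp: list_eq_iff_nth_eq nth_list_update)
    moreover have "?u \<sqsubseteq> ?u[i := One, j' := Zero]"
      using 3 assms by (intro right_update_le) auto
    ultimately show ?thesis by simp
  next
    case 4
    \<comment> \<open>Neither of the two rightmost coins was taken, so two Right moves bring them to
      the vacated places: \<open>i'\<close> to \<open>i\<close>, then \<open>j'\<close> to
      \<open>j\<close>.\<close>
    let ?v = "?u[i := One, i' := Zero]"
    have "?v[j := One, j' := Zero] = ?w"
      using 4 assms by (auto simp: list_eq_iff_nth_eq nth_list_update)
    moreover have "?u \<sqsubseteq> ?v"
      using 4 assms by (intro right_update_le) auto
    moreover have "?v \<sqsubseteq> ?v[j := One, j' := Zero]"
      using 4 assms by (intro right_update_le) auto
    ultimately show ?thesis using game_le_trans by metis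
  qed
qed

lemma best_left_mem: "coins_game \<delta> |\<in>| left_opts (coins_game (\<delta> @ One # zeros m @ [One]))"
  using left_move_mem[of \<delta> "zeros m" "[]"] coins_game_zeros[of \<delta> "Suc (Suc m)"]
  by (simp add: replicate_append_same)

text \<open>The string displays its two rightmost coins, at \<open>length \<delta>\<close> and
  \<open>length \<delta> + Suc m\<close>, so \<open>last_two_best\<close> applies. Taking them
  leaves \<open>\<delta>\<close> followed by zeros.\<close>

lemma best_left:
  assumes "X |\<in>| left_opts (coins_game (\<delta> @ One # zeros m @ [One]))"
  shows "X \<lesssim> coins_game \<delta>"
proof -
  let ?s = "\<delta> @ One # zeros m @ [One]"
  obtain i j where "i < j" "j < length ?s" "?s ! i" "?s ! j"
    and X: "X = coins_game (?s[i := Zero, j := Zero])"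
    using assms unfolding left_opts_coins_iff by blast
  then have "?s[i := Zero, j := Zero] \<sqsubseteq> ?s[length \<delta> := Zero, length \<delta> + Suc m := Zero]"
    by (intro last_two_best) (auto simp: nth_append nth_Cons split: if_splits nat.splits)
  then show ?thesis
    using X coins_game_zeros[of \<delta> "Suc (Suc m)"]
    by (simp add: list_update_append replicate_append_same)
qed

lemma best_left_less: "\<delta> \<sqsubset> \<delta> @ One # zeros m @ [One]"
  by (rule left_opt_less[OF best_left_mem])

lemma ones_append_Cons_eq:
  "\<beta> @ One # \<gamma> = ones c \<longleftrightarrow> (\<exists>x y. \<beta> = ones x \<and> \<gamma> = ones y \<and> c = Suc (x + y))"
proof
  assume eq: "\<beta> @ One # \<gamma> = ones c"
  then have "set (\<beta> @ One # \<gamma>) \<subseteq> {One}" by (simp only: set_replicate_conv_if) simp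
  then have "\<forall>x\<in>set \<beta>. x = One" "\<forall>x\<in>set \<gamma>. x = One" by auto
  then have "\<beta> = ones (length \<beta>)" "\<gamma> = ones (length \<gamma>)"
    by (simp_all only: replicate_length_same)
  moreover have "c = Suc (length \<beta> + length \<gamma>)"
    using arg_cong[OF eq, of length] by simp
  ultimately show "\<exists>x y. \<beta> = ones x \<and> \<gamma> = ones y \<and> c = Suc (x + y)" by blast
qed (auto simp: replicate_app_Cons_same simp flip: replicate_add)

lemma best_right_mem:
  "coins_game (\<sigma> @ One # Zero # \<tau>) |\<in>| right_opts (coins_game (\<sigma> @ Zero # One # \<tau>))"
  using right_move_mem[of \<sigma> "[]"] by simp

lemma best_right_less: "\<sigma> @ Zero # One # \<tau> \<sqsubset> \<sigma> @ One # Zero # \<tau>"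
  by (rule right_opt_greater[OF best_right_mem])

text \<open>For positive \<open>x\<close> this is one Right move, of the \<open>x\<close>-th coin of
  the block into the zero; for \<open>x = 0\<close> the two strings coincide.\<close>

lemma shift_into_ones: "\<sigma> @ Zero # ones (x + y) \<sqsubseteq> \<sigma> @ ones x @ Zero # ones y"
proof (cases x)
  case (Suc n)
  then show ?thesis
    using game_less_imp_le[OF right_move_greater[of \<sigma> "ones n" "ones y"]]
    by (simp add: replicate_app_Cons_same replicate_add)
qed simp

text \<open>Only a Right move inside \<open>\<sigma>\<close> needs the induction: any other option is reached from
  \<open>\<sigma> 1 0 1\<^sup>c\<close> by further Right moves.\<close>

lemma best_right:
  "Y |\<in>| right_opts (coins_game (\<sigma> @ Zero # One # ones c)) \<Longrightarrow>
    coins_game (\<sigma> @ One # Zero # ones c) \<lesssim> Y"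
proof (induction "weight (\<sigma> @ Zero # One # ones c)" arbitrary: \<sigma> c Y rule: less_induct)
  case less
  let ?P = "\<sigma> @ One # Zero # ones c"
  obtain \<alpha> \<beta> \<gamma> where split: "\<alpha> @ Zero # \<beta> @ One # \<gamma> = \<sigma> @ Zero # ones (Suc c)"
    and Y: "Y = coins_game (\<alpha> @ One # \<beta> @ Zero # \<gamma>)"
    using right_opts_coinsE[OF less.prems] by (metis replicate_Suc)
  consider (last) x y where "\<alpha> = \<sigma>" "\<beta> = ones x" "\<gamma> = ones y" "c = x + y"
    | (across) \<sigma>2 x y where "\<sigma> = \<alpha> @ Zero # \<sigma>2" "\<beta> = \<sigma>2 @ Zero # ones x" "\<gamma> = ones y" "c = x + y"
    | (inside) \<rho> where "\<sigma> = \<alpha> @ Zero # \<beta> @ One # \<rho>" "\<gamma> = \<rho> @ Zero # ones (Suc c)"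
  proof -
    have no_Zero: "ys \<noteq> us @ Zero # vs" if "ys = ones n" for us vs ys n
    proof
      assume "ys = us @ Zero # vs"
      then have "Zero \<in> set (ones n)" using that by (metis in_set_conv_decomp)
      then show False by simp
    qed
    consider us where "\<alpha> = \<sigma> @ us" "us @ Zero # \<beta> @ One # \<gamma> = Zero # ones (Suc c)"
      | us where "us \<noteq> []" "\<sigma> = \<alpha> @ us" "Zero # \<beta> @ One # \<gamma> = us @ Zero # ones (Suc c)"
      using split unfolding append_eq_append_conv2 by (metis append_Nil append_Nil2)
    then show thesis
    proof cases
      case (1 us)
      show thesis
      proof (cases us)
        case Nil
        then have "\<beta> @ One # \<gamma> = ones (Suc c)" using 1 by simp
        then show thesis using last 1 Nil by (auto simp: ones_append_Cons_eq simp del: replicate_Suc)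
      next
        case (Cons u us')
        then have "ones (Suc c) = us' @ Zero # \<beta> @ One # \<gamma>" using 1 by simp
        then show thesis using no_Zero by blast
      qed
    next
      case (2 us)
      then obtain us' where us: "us = Zero # us'"
        by (cases us) auto
      then have "\<beta> @ One # \<gamma> = us' @ Zero # ones (Suc c)" using 2 by simp
      then consider vs where "\<beta> = us' @ vs" "vs @ One # \<gamma> = Zero # ones (Suc c)"
        | vs where "us' = \<beta> @ vs" "One # \<gamma> = vs @ Zero # ones (Suc c)"
        unfolding append_eq_append_conv2 by metis
      then show thesis
      proof cases
        case (1 vs)
        then obtain vs' where vs: "vs = Zero # vs'" by (cases vs) auto
        then have "vs' @ One # \<gamma> = ones (Suc c)" using 1 by simp
        then obtain x y where "vs' = ones x" "\<gamma> = ones y" "c = x + y"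
          unfolding ones_append_Cons_eq by auto
        then show thesis using across[of us' x y] us vs 1 2 by simp
      next
        case (2 vs)
        then obtain vs' where vs: "vs = One # vs'" by (cases vs) auto
        then show thesis using inside[of vs'] us 2 \<open>\<sigma> = \<alpha> @ us\<close> by simp
      qed
    qed
  qed
  then show ?case
  proof cases
    case last
    then show ?thesis
      using shift_into_ones[of "\<sigma> @ [One]" x y] Y by simp
  next
    case across
    \<comment> \<open>The coin just before the last zero of \<open>?P\<close> moves into the zero
      behind \<open>\<alpha>\<close>; a shift within the final block of ones then gives
      \<open>Y\<close>.\<close>
    have "?P \<sqsubset> \<alpha> @ One # \<sigma>2 @ Zero # Zero # ones c"
      using right_move_greater[of \<alpha> \<sigma>2] across by simp
    also have "\<dots> \<lesssim> coins_game (\<alpha> @ One # \<sigma>2 @ Zero # ones x @ Zero # ones y)"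
      using shift_into_ones[of "\<alpha> @ One # \<sigma>2 @ [Zero]" x y] across by simp
    finally show ?thesis
      using Y across by (simp add: game_less_imp_le)
  next
    case inside
    let ?\<sigma> = "\<alpha> @ One # \<beta> @ Zero # \<rho>"
    let ?Q = "?\<sigma> @ Zero # One # ones c"
    have Y: "Y = coins_game ?Q" using Y inside by simp
    have weight: "weight ?Q < weight (\<sigma> @ Zero # One # ones c)"
      using weight_right_update[of "length \<alpha>" "length \<alpha> + Suc (length \<beta>)" "\<sigma> @ Zero # One # ones c"]
      by (simp add: inside nth_append list_update_append)
    show ?thesis unfolding Y
    proof (rule game_leI)
      fix Z assume "Z |\<in>| right_opts (coins_game ?Q)"
      then have "coins_game (?\<sigma> @ One # Zero # ones c) \<lesssim> Z"
        by (rule less.hyps[OF weight])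
      moreover have "?P \<sqsubset> ?\<sigma> @ One # Zero # ones c"
        using right_move_greater[of \<alpha> \<beta>] inside by simp
      ultimately show "\<not> Z \<lesssim> coins_game ?P"
        using game_le_trans by (auto simp: game_less_def)
    next
      fix Z assume Z: "Z |\<in>| left_opts (coins_game ?P)"
      have "Z \<prec> coins_game ?Q"
      proof -
        \<comment> \<open>The best Left option of \<open>?P\<close> takes its two rightmost coins.
          With \<open>c = 0\<close> this cuts into \<open>\<sigma>\<close>, with
          \<open>c = 1\<close> it leaves exactly \<open>\<sigma>\<close>, and otherwise it only
          shortens the final block.\<close>
        consider "c = 0" | "c = 1" | d where "c = Suc (Suc d)"
          by (metis One_nat_def not0_implies_Suc)
        then show ?thesis
        proof cases
          case 1
          then have Z': "Z |\<in>| left_opts (coins_game (\<sigma> @ [One]))"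
            using Z coins_game_snoc_Zero[of "\<sigma> @ [One]"] by simp
          show ?thesis
          proof (cases rule: zeros_or_last_One[of \<rho>])
            case (1 m)
            then have "Z \<lesssim> coins_game (\<alpha> @ Zero # \<beta>)"
              using Z' inside best_left[of Z "\<alpha> @ Zero # \<beta>" m] by simp
            \<comment> \<open>Left takes from \<open>?Q\<close> the coin behind
              \<open>\<alpha>\<close> and the last coin, after which only zeros follow
              \<open>\<beta>\<close>.\<close>
            also have "\<dots> \<prec> coins_game ?Q"
              using left_move_less[of \<alpha> "\<beta> @ Zero # zeros (Suc m)" "[]"] \<open>c = 0\<close> 1
                coins_game_zeros[of "\<alpha> @ Zero # \<beta>" "Suc (Suc (Suc m))"]
              by (simp add: replicate_append_same replicate_app_Cons_same)
            finally show ?thesis .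
          next
            case (2 \<rho>1 m)
            then have "Z \<lesssim> coins_game (\<alpha> @ Zero # \<beta> @ One # \<rho>1)"
              using Z' inside best_left[of Z "\<alpha> @ Zero # \<beta> @ One # \<rho>1" m] by simp
            also have "\<dots> \<prec> coins_game (\<alpha> @ One # \<beta> @ Zero # \<rho>1)"
              by (rule right_move_greater)
            also have "\<dots> \<prec> coins_game ?Q"
              using best_left_less[of "\<alpha> @ One # \<beta> @ Zero # \<rho>1" "Suc m"] \<open>c = 0\<close> 2
              by (simp add: replicate_append_same replicate_app_Cons_same)
            finally show ?thesis .
          qed
        next
          case 2
          then have "Z \<lesssim> coins_game \<sigma>"
            using Z best_left[of Z \<sigma> 1] by simp
          also have "\<dots> \<prec> coins_game ?\<sigma>"
            using right_move_greater inside by simp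
          also have "\<dots> = coins_game (?\<sigma> @ [Zero])"
            by (simp only: coins_game_snoc_Zero)
          also have "\<dots> \<prec> coins_game ?Q"
            using best_left_less[of "?\<sigma> @ [Zero]" 0] 2 by simp
          finally show ?thesis .
        next
          case 3
          let ?t = "?\<sigma> @ Zero # One # ones d"
          have c: "ones c = ones d @ [One, One]"
            using 3 by (simp add: replicate_append_same replicate_app_Cons_same)
          \<comment> \<open>The string without its last two coins is lighter, and \<open>?t\<close>
            is the result of the same inside move on it, so the induction hypothesis applies with
            \<open>d\<close> for \<open>c\<close>.\<close>
          have "weight (\<sigma> @ Zero # One # ones d) < weight (\<sigma> @ Zero # One # ones c)"
            using weight_snoc[of "\<sigma> @ Zero # One # ones d @ [One]" One]
              weight_snoc[of "\<sigma> @ Zero # One # ones d" One] c by simp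
          moreover have "coins_game ?t |\<in>| right_opts (coins_game (\<sigma> @ Zero # One # ones d))"
            using right_move_mem[of \<alpha> \<beta>] inside by simp
          ultimately have "coins_game (\<sigma> @ One # Zero # ones d) \<lesssim> coins_game ?t"
            by (rule less.hyps)
          moreover have "Z \<lesssim> coins_game (\<sigma> @ One # Zero # ones d)"
            using Z best_left[of Z "\<sigma> @ One # Zero # ones d" 0] c by simp
          moreover have "?t \<sqsubset> ?Q"
            using best_left_less[of ?t 0] c by simp
          ultimately show ?thesis
            using game_le_trans game_le_less_trans by blast
        qed
      qed
      then show "\<not> coins_game ?Q \<lesssim> Z" by (simp add: game_less_def)
    qed
  qed
qed

section \<open>Soundness of the reductions\<close>

text \<open>Domination suffices: if \<open>X \<lesssim> X'\<close> with \<open>X'\<close> a Left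
  option of \<open>H\<close>, then \<open>H \<lesssim> X\<close> would put \<open>H\<close> below
  its own Left option, and dually for Right.\<close>

lemma game_le_by_opts:
  assumes "\<And>X. X |\<in>| left_opts G \<Longrightarrow> \<exists>X'. X' |\<in>| left_opts H \<and> X \<lesssim> X'"
    and "\<And>Y. Y |\<in>| right_opts H \<Longrightarrow> \<exists>Y'. Y' |\<in>| right_opts G \<and> Y' \<lesssim> Y"
  shows "G \<lesssim> H"
proof (rule game_leI)
  fix X assume "X |\<in>| left_opts G"
  then show "\<not> H \<lesssim> X"
    using assms(1) game_le_trans left_opt_not_ge[OF game_le_refl] by blast
next
  fix Y assume "Y |\<in>| right_opts H"
  then show "\<not> Y \<lesssim> G"
    using assms(2) game_le_trans right_opt_not_le[OF game_le_refl] by blast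
qed

lemma coins_leI:
  assumes "\<And>X. X |\<in>| left_opts (coins_game s) \<Longrightarrow> X \<prec> coins_game t"
    and "\<And>Y. Y |\<in>| right_opts (coins_game t) \<Longrightarrow> coins_game s \<prec> Y"
  shows "s \<sqsubseteq> t"
  using assms by (intro game_leI) (auto simp: game_less_def)

lemma right_opts_ones: "right_opts (coins_game (ones c)) = {||}"
proof -
  have "Y |\<notin>| right_opts (coins_game (ones c))" for Y
    by (auto simp: right_opts_coins_iff)
  then show ?thesis by auto
qed

lemma left_opts_single: "left_opts (coins_game (zeros r @ [One])) = {||}"
proof -
  have "X |\<notin>| left_opts (coins_game (zeros r @ [One]))" for X
    by (auto simp: left_opts_coins_iff nth_append)
  then show ?thesis by auto
qed

lemma ones_or_last_Zero:
  obtains c where "s = ones c" | t c where "s = t @ Zero # ones c"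
proof (cases "Zero \<in> set s")
  case True
  then obtain t u where "s = t @ Zero # u" "Zero \<notin> set u"
    by (meson split_list_last)
  then show ?thesis
    using that(2) replicate_length_same[of u One] by metis
next
  case False
  then show ?thesis
    using that(1) replicate_length_same[of s One] by metis
qed

lemma weight_zeros [simp]: "weight (s @ zeros n) = weight s"
  by (induction n arbitrary: s) (simp_all add: weight_snoc flip: replicate_append_same append_assoc)

lemma weight_left_append: "weight (\<alpha> @ Zero # \<beta> @ Zero # \<gamma>) < weight (\<alpha> @ One # \<beta> @ One # \<gamma>)"
  using weight_left_update[of "length \<alpha>" "length \<alpha> + Suc (length \<beta>)" "\<alpha> @ One # \<beta> @ One # \<gamma>"]
  by (simp add: nth_append list_update_append)

lemma weight_right_append: "weight (\<alpha> @ One # \<beta> @ Zero # \<gamma>) < weight (\<alpha> @ Zero # \<beta> @ One # \<gamma>)"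
  using weight_right_update[of "length \<alpha>" "length \<alpha> + Suc (length \<beta>)" "\<alpha> @ Zero # \<beta> @ One # \<gamma>"]
  by (simp add: nth_append list_update_append)

lemma weight_best_left: "weight \<delta> < weight (\<delta> @ One # zeros m @ [One])"
  using weight_left_append[of \<delta> "zeros m" "[]"] weight_zeros[of \<delta> "Suc (Suc m)"]
  by (simp add: replicate_append_same)

lemma game_eq_sym: "G \<approx> H \<Longrightarrow> H \<approx> G"
  by (simp add: game_eq_def)

lemma game_eq_best:
  assumes "\<And>X. X |\<in>| left_opts G \<Longrightarrow> X \<lesssim> X1" "X1 |\<in>| left_opts G"
    and "\<And>X. X |\<in>| left_opts H \<Longrightarrow> X \<lesssim> X2" "X2 |\<in>| left_opts H" and "X1 \<approx> X2"
    and "\<And>Y. Y |\<in>| right_opts G \<Longrightarrow> Y1 \<lesssim> Y" "Y1 |\<in>| right_opts G"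
    and "\<And>Y. Y |\<in>| right_opts H \<Longrightarrow> Y2 \<lesssim> Y" "Y2 |\<in>| right_opts H" and "Y1 \<approx> Y2"
  shows "G \<approx> H"
  unfolding game_eq_def
proof
  show "G \<lesssim> H"
    by (rule game_le_by_opts) (use assms game_le_trans in \<open>unfold game_eq_def; blast\<close>)+
  show "H \<lesssim> G"
    by (rule game_le_by_opts) (use assms game_le_trans in \<open>unfold game_eq_def; blast\<close>)+
qed

text \<open>With no coin behind the three ones, the best Left options do not correspond: one is
  \<open>\<alpha> 0 1\<close>, the other cuts into \<open>\<alpha>\<close>. So the options of each
  position are compared with the other position itself. \<open>IH\<close> is the same claim at
  smaller weight.\<close>

lemma reduction_nil:
  assumes IH: "\<And>\<alpha>'. weight (\<alpha>' @ [Zero, One, One, One]) < weight (\<alpha> @ [Zero, One, One, One]) \<Longrightarrow>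
    coins_game (\<alpha>' @ [Zero, One, One, One]) \<approx> coins_game (\<alpha>' @ [One])"
  shows "coins_game (\<alpha> @ [Zero, One, One, One]) \<approx> coins_game (\<alpha> @ [One])"
  unfolding game_eq_def
proof
  let ?s = "\<alpha> @ [Zero, One, One, One]"
  show "?s \<sqsubseteq> \<alpha> @ [One]"
  proof (rule coins_leI)
    fix X assume "X |\<in>| left_opts (coins_game ?s)"
    then have "X \<lesssim> coins_game (\<alpha> @ [Zero, One])"
      using best_left[of X "\<alpha> @ [Zero, One]" 0] by simp
    also have "\<dots> \<prec> coins_game (\<alpha> @ [One, Zero])"
      using best_right_less[of \<alpha> "[]"] by simp
    also have "\<dots> = coins_game (\<alpha> @ [One])"
      using coins_game_snoc_Zero[of "\<alpha> @ [One]"] by simp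
    finally show "X \<prec> coins_game (\<alpha> @ [One])" .
  next
    fix Y assume Y: "Y |\<in>| right_opts (coins_game (\<alpha> @ [One]))"
    show "coins_game ?s \<prec> Y"
    proof (cases rule: ones_or_last_Zero[of \<alpha>])
      case (1 c)
      then show ?thesis
        using Y right_opts_ones[of "Suc c"] by (simp add: replicate_append_same)
    next
      case (2 \<sigma> c)
      then have Yge: "coins_game (\<sigma> @ One # Zero # ones c) \<lesssim> Y"
        using Y best_right[of Y \<sigma> c] by (simp add: replicate_append_same)
      show ?thesis
      proof (cases c)
        case 0
        \<comment> \<open>Here \<open>?s\<close> is \<open>\<sigma>\<close> followed by
          \<open>0 0 1 1 1\<close>. Right moves the last coin into the second of these zeros, and
          \<open>IH\<close> equates the result with \<open>\<sigma> 1\<close>.\<close>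
        have "weight (\<sigma> @ [Zero, One, One, One]) < weight ?s"
          using weight_right_append[of "\<sigma> @ [Zero]" "[One, One]" "[]"] 2 0
            weight_zeros[of "\<sigma> @ [Zero, One, One, One]" 1] by simp
        then have "coins_game (\<sigma> @ [Zero, One, One, One]) \<approx> coins_game (\<sigma> @ [One])"
          by (rule IH)
        moreover have "?s \<sqsubset> \<sigma> @ [Zero, One, One, One]"
          using right_move_greater[of "\<sigma> @ [Zero]" "[One, One]" "[]"] 2 0
            coins_game_snoc_Zero[of "\<sigma> @ [Zero, One, One, One]"] by simp
        moreover have "coins_game (\<sigma> @ [One]) \<lesssim> Y"
          using Yge 0 coins_game_snoc_Zero[of "\<sigma> @ [One]"] by simp
        ultimately show ?thesis
          unfolding game_eq_def using game_less_le_trans by blast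
      next
        case (Suc d)
        \<comment> \<open>Right moves at the rightmost \<open>0 1\<close> within
          \<open>\<alpha>\<close>, which turns \<open>\<alpha>\<close> into \<open>?\<sigma>\<close>
          and keeps the final \<open>0 1 1 1\<close> for \<open>IH\<close>.\<close>
        let ?\<sigma> = "\<sigma> @ One # Zero # ones d"
        have "weight (?\<sigma> @ [Zero, One, One, One]) < weight ?s"
          using weight_right_append[of \<sigma> "[]"] 2 Suc by simp
        then have "coins_game (?\<sigma> @ [Zero, One, One, One]) \<approx> coins_game (?\<sigma> @ [One])"
          by (rule IH)
        moreover have "?s \<sqsubset> ?\<sigma> @ [Zero, One, One, One]"
          using best_right_less[of \<sigma>] 2 Suc by simp
        moreover have "coins_game (?\<sigma> @ [One]) \<lesssim> Y"
          using Yge Suc by (simp add: replicate_append_same)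
        ultimately show ?thesis
          unfolding game_eq_def using game_less_le_trans by blast
      qed
    qed
  qed
  show "\<alpha> @ [One] \<sqsubseteq> ?s"
  proof (rule coins_leI)
    fix X assume X: "X |\<in>| left_opts (coins_game (\<alpha> @ [One]))"
    show "X \<prec> coins_game ?s"
    proof (cases rule: zeros_or_last_One[of \<alpha>])
      case (1 m)
      then show ?thesis using X left_opts_single by simp
    next
      case (2 \<tau> m)
      then have "X \<lesssim> coins_game \<tau>"
        using X best_left[of X \<tau> m] by simp
      \<comment> \<open>Left goes from \<open>?s\<close> to \<open>\<tau>\<close> in two moves:
        first the coin behind \<open>\<tau>\<close> with the first of the three final ones, then the
        last two. The first move leaves \<open>m + 1\<close> old zeros and two new ones.\<close>
      also have "\<dots> = coins_game (\<tau> @ zeros (Suc (Suc (Suc m))))"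
        by (rule coins_game_zeros[symmetric])
      also have "\<dots> \<prec> coins_game (\<tau> @ zeros (Suc (Suc (Suc m))) @ [One, One])"
        using best_left_less[of "\<tau> @ zeros (Suc (Suc (Suc m)))" 0] by simp
      also have "\<dots> \<prec> coins_game ?s"
        using left_move_less[of \<tau> "zeros (Suc m)" "[One, One]"] 2
        by (simp add: replicate_app_Cons_same)
      finally show ?thesis .
    qed
  next
    fix Y assume "Y |\<in>| right_opts (coins_game ?s)"
    then have "coins_game (\<alpha> @ [One, Zero, One, One]) \<lesssim> Y"
      using best_right[of Y \<alpha> 2] by (simp add: numeral_2_eq_2)
    moreover have "\<alpha> @ [One] \<sqsubset> \<alpha> @ [One, Zero, One, One]"
      using best_left_less[of "\<alpha> @ [One, Zero]" 0] coins_game_snoc_Zero[of "\<alpha> @ [One]"] by simp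
    ultimately show "coins_game (\<alpha> @ [One]) \<prec> Y"
      by (rule game_less_le_trans[rotated])
  qed
qed

text \<open>The best Right options agree by \<open>IH\<close>: both have the value of
  \<open>\<alpha> 1 1\<close>. The best Left options \<open>\<alpha> 0 1 1\<close> and
  \<open>\<alpha>\<close> do not correspond, since on the right-hand side Left takes the coin in
  front of the zero. Left options are therefore compared with the opposite position.\<close>

lemma reduction_single:
  assumes IH: "coins_game (\<alpha> @ [One, Zero, One, One, One]) \<approx> coins_game (\<alpha> @ [One, One])"
  shows "coins_game (\<alpha> @ [Zero, One, One, One, One]) \<approx> coins_game (\<alpha> @ [One, Zero, One])"
  unfolding game_eq_def
proof
  let ?s = "\<alpha> @ [Zero, One, One, One, One]" and ?t = "\<alpha> @ [One, Zero, One]"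
  have s_less: "?s \<sqsubset> \<alpha> @ [One, One]"
    using best_right_less[of \<alpha> "[One, One, One]"] IH game_less_le_trans by (auto simp: game_eq_def)
  have t_less: "?t \<sqsubset> \<alpha> @ [One, One]"
    using best_right_less[of "\<alpha> @ [One]" "[]"] coins_game_snoc_Zero[of "\<alpha> @ [One, One]"] by simp
  show "?s \<sqsubseteq> ?t"
  proof (rule coins_leI)
    fix X assume "X |\<in>| left_opts (coins_game ?s)"
    then have "X \<lesssim> coins_game (\<alpha> @ [Zero, One, One])"
      using best_left[of X "\<alpha> @ [Zero, One, One]" 0] by simp
    also have "\<dots> \<prec> coins_game ?t"
      using best_right_less[of \<alpha> "[One]"] by simp
    finally show "X \<prec> coins_game ?t" .
  next
    fix Y assume "Y |\<in>| right_opts (coins_game ?t)"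
    then have "coins_game (\<alpha> @ [One, One]) \<lesssim> Y"
      using best_right[of Y "\<alpha> @ [One]" 0] coins_game_snoc_Zero[of "\<alpha> @ [One, One]"] by simp
    with s_less show "coins_game ?s \<prec> Y" by (rule game_less_le_trans)
  qed
  show "?t \<sqsubseteq> ?s"
  proof (rule coins_leI)
    fix X assume "X |\<in>| left_opts (coins_game ?t)"
    then have "X \<lesssim> coins_game \<alpha>"
      using best_left[of X \<alpha> 1] by simp
    also have "\<dots> = coins_game (\<alpha> @ [Zero])" by simp
    also have "\<dots> \<prec> coins_game (\<alpha> @ [Zero, One, One])"
      using best_left_less[of "\<alpha> @ [Zero]" 0] by simp
    also have "\<dots> \<prec> coins_game ?s"
      using best_left_less[of "\<alpha> @ [Zero, One, One]" 0] by simp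
    finally show "X \<prec> coins_game ?s" .
  next
    fix Y assume "Y |\<in>| right_opts (coins_game ?s)"
    then have "coins_game (\<alpha> @ [One, Zero, One, One, One]) \<lesssim> Y"
      using best_right[of Y \<alpha> 3] by (simp add: numeral_3_eq_3)
    with IH have "coins_game (\<alpha> @ [One, One]) \<lesssim> Y"
      unfolding game_eq_def using game_le_trans by blast
    with t_less show "coins_game ?t \<prec> Y" by (rule game_less_le_trans)
  qed
qed

text \<open>The assumption covers both rules, and it survives the best moves: removing the last two
  coins of \<open>\<beta>\<close> keeps the parity or leaves an initial 1 or no symbol at all, and
  moving the rightmost \<open>0 1\<close> within \<open>\<beta>\<close> keeps the parity and any
  initial 1. Hence best options correspond once \<open>\<beta>\<close> has two coins; no coin and
  one coin are the two preceding lemmas.\<close>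

lemma reduction:
  assumes "even (count_list \<beta> One) \<or> (\<exists>\<beta>'. \<beta> = One # \<beta>')"
  shows "coins_game (\<alpha> @ Zero # One # One # One # \<beta>) \<approx> coins_game (\<alpha> @ One # Zero # \<beta>)"
  using assms
proof (induction "weight (\<alpha> @ Zero # One # One # One # \<beta>)" arbitrary: \<alpha> \<beta> rule: less_induct)
  case less
  let ?S = "\<lambda>\<alpha> \<beta>. \<alpha> @ Zero # One # One # One # \<beta>" and ?T = "\<lambda>\<alpha> \<beta>. \<alpha> @ One # Zero # \<beta>"
  show ?case
  proof (cases rule: zeros_or_last_One[of \<beta>])
    case (1 m)
    have "coins_game (?S \<alpha> []) \<approx> coins_game (\<alpha> @ [One])"
    proof (rule reduction_nil)
      fix \<alpha>' assume "weight (?S \<alpha>' []) < weight (?S \<alpha> [])"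
      then have "weight (?S \<alpha>' []) < weight (?S \<alpha> \<beta>)"
        using 1 weight_zeros[of "?S \<alpha> []" m] by simp
      from less.hyps[OF this] show "coins_game (?S \<alpha>' []) \<approx> coins_game (\<alpha>' @ [One])"
        using coins_game_snoc_Zero[of "\<alpha>' @ [One]"] by simp
    qed
    then show ?thesis
      using 1 coins_game_zeros[of "?S \<alpha> []" m] coins_game_zeros[of "\<alpha> @ [One]" "Suc m"] by simp
  next
    case (2 t m)
    have weight_s: "weight (?S \<alpha> \<beta>) = weight (?S \<alpha> (t @ [One]))"
      using 2 weight_zeros[of "?S \<alpha> (t @ [One])" m] by simp
    have "coins_game (?S \<alpha> (t @ [One])) \<approx> coins_game (?T \<alpha> (t @ [One]))"
    proof (cases rule: zeros_or_last_One[of t])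
      case (1 n)
      \<comment> \<open>\<open>\<beta>\<close> has exactly one coin, an odd number, so the
        assumption forces it to begin with that coin.\<close>
      have "n = 0"
        using less.prems 1 2 by (cases n) auto
      have "weight (?S (\<alpha> @ [One]) []) < weight (?S \<alpha> \<beta>)"
        using weight_right_append[of \<alpha> "[]"] weight_s 1 \<open>n = 0\<close> by simp
      from less.hyps[OF this]
      have "coins_game (\<alpha> @ [One, Zero, One, One, One]) \<approx> coins_game (\<alpha> @ [One, One])"
        using coins_game_snoc_Zero[of "\<alpha> @ [One, One]"] by simp
      then show ?thesis
        using reduction_single 1 \<open>n = 0\<close> by simp
    next
      case t: (2 \<delta> n)
      have cond: "even (count_list \<delta> One) \<or> (\<exists>\<delta>'. \<delta> = One # \<delta>')"
        using less.prems 2 t by (cases \<delta>) auto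
      have "weight (?S \<alpha> \<delta>) < weight (?S \<alpha> \<beta>)"
        using weight_best_left[of "?S \<alpha> \<delta>" n] weight_s t by simp
      from less.hyps[OF this cond]
      have IHL: "coins_game (?S \<alpha> \<delta>) \<approx> coins_game (?T \<alpha> \<delta>)" .
      obtain r1 r2 where IHR: "coins_game r1 \<approx> coins_game r2"
        and r1: "coins_game r1 |\<in>| right_opts (coins_game (?S \<alpha> (t @ [One])))"
          "\<And>Y. Y |\<in>| right_opts (coins_game (?S \<alpha> (t @ [One]))) \<Longrightarrow> coins_game r1 \<lesssim> Y"
        and r2: "coins_game r2 |\<in>| right_opts (coins_game (?T \<alpha> (t @ [One])))"
          "\<And>Y. Y |\<in>| right_opts (coins_game (?T \<alpha> (t @ [One]))) \<Longrightarrow> coins_game r2 \<lesssim> Y"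
      proof (cases rule: ones_or_last_Zero[of t])
        case (1 c)
        \<comment> \<open>Behind the displayed zero there are only ones, so on both sides it is this
          zero that Right fills; \<open>\<alpha>\<close> gains a 1 and \<open>\<beta>\<close>
          becomes \<open>ones c\<close>.\<close>
        have "weight (?S (\<alpha> @ [One]) (ones c)) < weight (?S \<alpha> \<beta>)"
          using weight_right_append[of \<alpha> "[]"] weight_s 1 by (simp add: replicate_append_same)
        moreover have "even (count_list (ones c) One) \<or> (\<exists>\<beta>'. ones c = One # \<beta>')"
          by (cases c) auto
        ultimately have "coins_game (?S (\<alpha> @ [One]) (ones c)) \<approx> coins_game (?T (\<alpha> @ [One]) (ones c))"
          by (rule less.hyps)
        then show ?thesis
          using that[of "?S (\<alpha> @ [One]) (ones c)" "?T (\<alpha> @ [One]) (ones c)"] 1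
            best_right_mem[of \<alpha> "One # One # One # ones c"] best_right[of _ \<alpha> "Suc (Suc (Suc c))"]
            best_right_mem[of "\<alpha> @ [One]" "ones c"] best_right[of _ "\<alpha> @ [One]" c]
          by (simp add: replicate_append_same)
      next
        case (2 \<rho> c)
        let ?\<beta> = "\<rho> @ One # Zero # ones c"
        have "weight (?S \<alpha> ?\<beta>) < weight (?S \<alpha> \<beta>)"
          using weight_right_append[of "?S \<alpha> \<rho>" "[]"] weight_s 2 by (simp add: replicate_append_same)
        moreover have "even (count_list ?\<beta> One) \<or> (\<exists>\<beta>'. ?\<beta> = One # \<beta>')"
          using less.prems 2 \<open>\<beta> = t @ One # zeros m\<close> by (cases \<rho>) auto
        ultimately have "coins_game (?S \<alpha> ?\<beta>) \<approx> coins_game (?T \<alpha> ?\<beta>)"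
          by (rule less.hyps)
        then show ?thesis
          using that[of "?S \<alpha> ?\<beta>" "?T \<alpha> ?\<beta>"] 2
            best_right_mem[of "?S \<alpha> \<rho>" "ones c"] best_right[of _ "?S \<alpha> \<rho>" c]
            best_right_mem[of "?T \<alpha> \<rho>" "ones c"] best_right[of _ "?T \<alpha> \<rho>" c]
          by (simp add: replicate_append_same)
      qed
      show ?thesis
      proof (rule game_eq_best[OF _ _ _ _ IHL _ _ _ _ IHR])
        show "coins_game (?S \<alpha> \<delta>) |\<in>| left_opts (coins_game (?S \<alpha> (t @ [One])))"
          using best_left_mem[of "?S \<alpha> \<delta>" n] t by simp
        show "X \<lesssim> coins_game (?S \<alpha> \<delta>)"
          if "X |\<in>| left_opts (coins_game (?S \<alpha> (t @ [One])))" for X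
          using best_left[of X "?S \<alpha> \<delta>" n] t that by simp
        show "coins_game (?T \<alpha> \<delta>) |\<in>| left_opts (coins_game (?T \<alpha> (t @ [One])))"
          using best_left_mem[of "?T \<alpha> \<delta>" n] t by simp
        show "X \<lesssim> coins_game (?T \<alpha> \<delta>)"
          if "X |\<in>| left_opts (coins_game (?T \<alpha> (t @ [One])))" for X
          using best_left[of X "?T \<alpha> \<delta>" n] t that by simp
      qed (use r1 r2 in blast)+
    qed
    then show ?thesis
      using 2 coins_game_zeros[of "?S \<alpha> (t @ [One])" m] coins_game_zeros[of "?T \<alpha> (t @ [One])" m]
      by simp
  qed
qed

lemma reduct_sound: "reduct s t \<Longrightarrow> coins_game s \<approx> coins_game t"
proof (induction rule: reduct.induct)
  case (reduct_a j \<alpha> \<beta>)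
  then obtain i where "j = Suc i" by (cases j) auto
  then show ?case
    using reduction[of "ones j @ \<beta>" \<alpha>] by (simp add: numeral_3_eq_3)
next
  case (reduct_b \<beta> \<alpha>)
  then show ?case
    using reduction[of \<beta> \<alpha>] by (simp add: numeral_3_eq_3)
qed

lemma reduct_rtranclp_sound: "reduct\<^sup>*\<^sup>* s t \<Longrightarrow> coins_game s \<approx> coins_game t"
  by (induction rule: rtranclp_induct) (auto intro: game_eq_trans reduct_sound)

section \<open>Ordinal sums\<close>

text \<open>The ordinal sum \<open>v : H\<close> depends on the form of \<open>v\<close>, not only on its value.  The property of the
  form that survives the recursion is that its Right options are as good as those of the position.\<close>

definition same_right_opts :: "game \<Rightarrow> game \<Rightarrow> bool" where
  "same_right_opts G H \<longleftrightarrow>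
     (\<forall>Y. Y |\<in>| right_opts G \<longrightarrow> (\<exists>Z. Z |\<in>| right_opts H \<and> Z \<lesssim> Y)) \<and>
     (\<forall>Z. Z |\<in>| right_opts H \<longrightarrow> (\<exists>Y. Y |\<in>| right_opts G \<and> Y \<lesssim> Z))"

text \<open>If \<open>q > 0\<close> the last coin moves, and \<open>(p, q)\<close> becomes \<open>(p, q - 1)\<close>; if \<open>q = 0\<close> the coin before
  it moves, and \<open>(p, 0)\<close> becomes \<open>(p - 1, 1)\<close>.\<close>

lemma shift_last_pair:
  assumes "2 * p + q = Suc k"
  obtains p' q' where "2 * p' + q' = k"
    and "coins_game (\<sigma> @ zeros p' @ One # zeros q' @ [One])
      |\<in>| right_opts (coins_game (\<sigma> @ zeros p @ One # zeros q @ [One]))"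
    and "\<And>Y. Y |\<in>| right_opts (coins_game (\<sigma> @ zeros p @ One # zeros q @ [One])) \<Longrightarrow>
      coins_game (\<sigma> @ zeros p' @ One # zeros q' @ [One]) \<lesssim> Y"
proof (cases q)
  case 0
  then obtain p' where p: "p = Suc p'" using assms by (cases p) auto
  show ?thesis
    using that[of p' 1] best_right_mem[of "\<sigma> @ zeros p'" "[One]"] best_right[of _ "\<sigma> @ zeros p'" 1]
      assms 0 p by (simp add: replicate_app_Cons_same)
next
  case (Suc q')
  let ?\<sigma> = "\<sigma> @ zeros p @ One # zeros q'"
  have "coins_game (?\<sigma> @ [One, Zero]) = coins_game (?\<sigma> @ [One])"
    using coins_game_snoc_Zero[of "?\<sigma> @ [One]"] by simp
  then show ?thesis
    using that[of p q'] best_right_mem[of ?\<sigma> "[]"] best_right[of _ ?\<sigma> 0] assms Suc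
    by (simp add: replicate_app_Cons_same)
qed

lemma dyadic_whole [simp]: "dyadic (int n * 2 ^ k) k = nat_game n"
  by (induction k) (simp_all add: algebra_simps)

lemma dyadic_zero [simp]: "dyadic 0 k = nat_game 0"
  by (induction k) simp_all

text \<open>The Left option 0 of the exponent contributes \<open>v : 0\<close>, which is
  \<open>v\<close> as a form. The exponent 1 has no Right option, whereas half of a power
  \<open>1 / 2^k\<close> has \<open>1 / 2^k\<close> itself.\<close>

lemma opts_ordinal_sum_dyadic_0:
  "left_opts (ordinal_sum v (dyadic 1 0)) = finsert v (left_opts v)"
  "right_opts (ordinal_sum v (dyadic 1 0)) = right_opts v"
  by simp_all

lemma opts_ordinal_sum_dyadic_Suc:
  "left_opts (ordinal_sum v (dyadic 1 (Suc k))) = finsert v (left_opts v)"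
  "right_opts (ordinal_sum v (dyadic 1 (Suc k))) =
     finsert (ordinal_sum v (dyadic 1 k)) (right_opts v)"
  by simp_all

text \<open>The new Left option \<open>v\<close> matches the best Left option of \<open>?G\<close>.
  An old one, \<open>X\<close>, cannot satisfy \<open>?G \<lesssim> X\<close>: since
  \<open>v\<close> lies below \<open>?G\<close>, this would give \<open>v \<lesssim> X\<close> for a
  Left option \<open>X\<close> of \<open>v\<close>. Thus no comparison of \<open>X\<close> with the
  options of \<open>?G\<close> is required.\<close>

lemma eq_of_same_right_opts:
  assumes left: "left_opts v' = finsert v (left_opts v)"
    and v: "v \<approx> coins_game \<delta>"
    and right: "same_right_opts v' (coins_game (\<delta> @ One # zeros q @ [One]))" (is "same_right_opts v' ?G")
  shows "v' \<approx> ?G"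
  unfolding game_eq_def
proof
  have less: "coins_game \<delta> \<prec> ?G" by (rule best_left_less)
  show "v' \<lesssim> ?G"
  proof (rule game_leI)
    fix X assume "X |\<in>| left_opts v'"
    then have "X = v \<or> X |\<in>| left_opts v" by (simp add: left)
    moreover have "\<not> v \<lesssim> X" if "X |\<in>| left_opts v"
      using that by (rule left_opt_not_ge[OF game_le_refl])
    ultimately show "\<not> ?G \<lesssim> X"
      using less v game_le_trans unfolding game_less_def game_eq_def by blast
  next
    fix Y assume "Y |\<in>| right_opts ?G"
    then show "\<not> Y \<lesssim> v'"
      using right right_opt_not_le[OF game_le_refl] game_le_trans
      unfolding same_right_opts_def by blast
  qed
  show "?G \<lesssim> v'"
  proof (rule game_le_by_opts)
    fix X assume "X |\<in>| left_opts ?G"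
    then have "X \<lesssim> v"
      using best_left v game_le_trans unfolding game_eq_def by blast
    then show "\<exists>X'. X' |\<in>| left_opts v' \<and> X \<lesssim> X'" by (auto simp: left)
  qed (use right in \<open>simp add: same_right_opts_def\<close>)
qed

text \<open>Passing to the Right option of the exponent and making the best Right move both lower
  \<open>2 * p + q\<close> by 1, so the induction is on the exponent. \<open>same_right_opts\<close>
  is part of the conclusion because the result serves as the base of the next ordinal sum.\<close>

lemma ordinal_sum_sound:
  assumes v: "v \<approx> coins_game (\<alpha> @ Zero # ones (Suc b))"
    and right: "same_right_opts v (coins_game (\<alpha> @ Zero # ones (Suc b)))"
  shows "2 * p + q = Suc k \<Longrightarrow>
    same_right_opts (ordinal_sum v (dyadic 1 k))
      (coins_game (\<alpha> @ Zero # ones (Suc b) @ zeros p @ One # zeros q @ [One])) \<and>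
    ordinal_sum v (dyadic 1 k) \<approx>
      coins_game (\<alpha> @ Zero # ones (Suc b) @ zeros p @ One # zeros q @ [One])"
proof (induction k arbitrary: p q)
  case 0
  then have pq: "p = 0" "q = 1" by presburger+
  let ?H = "\<alpha> @ Zero # ones (Suc b)"
  let ?G = "?H @ zeros p @ One # zeros q @ [One]"
  let ?RH = "\<alpha> @ One # Zero # ones b" and ?RG = "\<alpha> @ Zero # One # One # One # ones b"
  have RH: "coins_game ?RH |\<in>| right_opts (coins_game ?H)"
    "\<And>Y. Y |\<in>| right_opts (coins_game ?H) \<Longrightarrow> coins_game ?RH \<lesssim> Y"
    using best_right_mem[of \<alpha> "ones b"] best_right[of _ \<alpha> b] by simp_all
  have RG_eq: "coins_game (?H @ [One, One, Zero]) = coins_game ?RG"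
    using coins_game_snoc_Zero[of ?RG] by (simp add: replicate_app_Cons_same replicate_append_same)
  have RG: "coins_game ?RG |\<in>| right_opts (coins_game ?G)"
    "\<And>Y. Y |\<in>| right_opts (coins_game ?G) \<Longrightarrow> coins_game ?RG \<lesssim> Y"
    using best_right_mem[of "?H @ [One]" "[]"] best_right[of _ "?H @ [One]" 0] RG_eq pq by simp_all
  \<comment> \<open>\<open>ones b\<close> is empty or begins with a 1, as \<open>reduction\<close>
    demands. So the Right options of \<open>v\<close>, to which the exponent 1 adds nothing, match
    those of \<open>?G\<close>.\<close>
  have "coins_game ?RG \<approx> coins_game ?RH"
    by (rule reduction) (cases b; simp)
  then have "same_right_opts v (coins_game ?G)"
    using right RH RG game_le_trans unfolding same_right_opts_def game_eq_def by meson
  then have same: "same_right_opts (ordinal_sum v (dyadic 1 0)) (coins_game ?G)"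
    by (simp add: same_right_opts_def)
  then show ?case
    using eq_of_same_right_opts[of "ordinal_sum v (dyadic 1 0)" v ?H q] v pq by simp
next
  case (Suc k)
  let ?H = "\<alpha> @ Zero # ones (Suc b)"
  let ?G = "?H @ zeros p @ One # zeros q @ [One]"
  obtain p' q' where pq': "2 * p' + q' = Suc k"
    and mem: "coins_game (?H @ zeros p' @ One # zeros q' @ [One]) |\<in>| right_opts (coins_game ?G)"
    and best: "\<And>Y. Y |\<in>| right_opts (coins_game ?G) \<Longrightarrow>
      coins_game (?H @ zeros p' @ One # zeros q' @ [One]) \<lesssim> Y"
    using shift_last_pair[OF Suc.prems, of ?H] by blast
  let ?R = "?H @ zeros p' @ One # zeros q' @ [One]" and ?v' = "ordinal_sum v (dyadic 1 k)"
  have IH: "same_right_opts ?v' (coins_game ?R)" "?v' \<approx> coins_game ?R"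
    using Suc.IH[OF pq'] by simp_all
  \<comment> \<open>A Right option of the base remains one in every ordinal sum, hence in
    \<open>?v'\<close>. By induction some Right option of \<open>?R\<close> lies below it, and
    \<open>?R\<close> lies below that.\<close>
  have le: "coins_game ?R \<lesssim> Y" if "Y |\<in>| right_opts v" for Y
  proof -
    have "Y |\<in>| right_opts ?v'"
      using that opts_ordinal_sum_dyadic_0(2) opts_ordinal_sum_dyadic_Suc(2)
      by (cases k) (simp_all del: dyadic.simps)
    then obtain Z where "Z |\<in>| right_opts (coins_game ?R)" "Z \<lesssim> Y"
      using IH(1) unfolding same_right_opts_def by blast
    then show ?thesis
      using right_opt_greater game_less_imp_le game_le_trans by blast
  qed
  have same: "same_right_opts (ordinal_sum v (dyadic 1 (Suc k))) (coins_game ?G)"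
    unfolding same_right_opts_def opts_ordinal_sum_dyadic_Suc
  proof (intro conjI allI impI)
    fix Y assume "Y |\<in>| finsert ?v' (right_opts v)"
    then have "coins_game ?R \<lesssim> Y"
      using le IH(2) by (auto simp: game_eq_def)
    with mem show "\<exists>Z. Z |\<in>| right_opts (coins_game ?G) \<and> Z \<lesssim> Y" by blast
  next
    fix Z assume "Z |\<in>| right_opts (coins_game ?G)"
    then have "?v' \<lesssim> Z"
      using best IH(2) game_le_trans unfolding game_eq_def by blast
    then show "\<exists>Y. Y |\<in>| finsert ?v' (right_opts v) \<and> Y \<lesssim> Z" by blast
  qed
  have "v \<approx> coins_game (?H @ zeros p)" using v by (simp only: coins_game_zeros)
  then have "ordinal_sum v (dyadic 1 (Suc k)) \<approx> coins_game ((?H @ zeros p) @ One # zeros q @ [One])"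
    using same by (intro eq_of_same_right_opts) (simp_all add: opts_ordinal_sum_dyadic_Suc del: dyadic.simps)
  with same show ?case by simp
qed

section \<open>Values of base strings and of the evaluation\<close>

lemma single_sound:
  "same_right_opts (neg_nat_game r) (coins_game (zeros r @ [One])) \<and>
   neg_nat_game r \<approx> coins_game (zeros r @ [One])"
proof (induction r)
  case 0
  then show ?case
    using left_opts_single[of 0] right_opts_ones[of 1]
    by (auto simp: same_right_opts_def game_eq_def intro!: game_leI)
next
  case (Suc r)
  let ?G = "zeros (Suc r) @ [One]"
  have mem: "coins_game (zeros r @ [One]) |\<in>| right_opts (coins_game ?G)"
    and best: "\<And>Y. Y |\<in>| right_opts (coins_game ?G) \<Longrightarrow> coins_game (zeros r @ [One]) \<lesssim> Y"
    using best_right_mem[of "zeros r" "[]"] best_right[of _ "zeros r" 0]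
      coins_game_snoc_Zero[of "zeros r @ [One]"] by (simp_all add: replicate_app_Cons_same)
  have same: "same_right_opts (neg_nat_game (Suc r)) (coins_game ?G)"
    using Suc mem best game_le_trans unfolding same_right_opts_def game_eq_def by auto
  moreover have "neg_nat_game (Suc r) \<approx> coins_game ?G"
    using same left_opts_single[of "Suc r"] unfolding game_eq_def same_right_opts_def
    by (auto intro!: game_le_by_opts)
  ultimately show ?case by simp
qed

lemma right_opts_nat_game: "right_opts (nat_game n) = {||}"
  by (cases n) simp_all

text \<open>Right has no move, and Left's best move removes two coins from the end; a single coin is
  worth nothing, hence the rounding down.\<close>

lemma ones_sound: "nat_game (c div 2) \<approx> coins_game (ones c)"
proof (induction c rule: induct_nat_012)
  case (ge2 c)
  let ?G = "coins_game (ones (Suc (Suc c)))"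
  have left: "coins_game (ones c) |\<in>| left_opts ?G"
    "\<And>X. X |\<in>| left_opts ?G \<Longrightarrow> X \<lesssim> coins_game (ones c)"
    using best_left_mem[of "ones c" 0] best_left[of _ "ones c" 0]
    by (simp_all add: replicate_append_same replicate_app_Cons_same)
  have IH: "nat_game (c div 2) \<lesssim> coins_game (ones c)" "coins_game (ones c) \<lesssim> nat_game (c div 2)"
    using ge2(1) by (simp_all add: game_eq_def)
  have "nat_game (Suc (c div 2)) \<lesssim> ?G"
    using left(1) IH(1) by (intro game_le_by_opts) (auto simp: right_opts_ones simp del: replicate_Suc)
  moreover have "?G \<lesssim> nat_game (Suc (c div 2))"
  proof (rule game_le_by_opts)
    fix X assume "X |\<in>| left_opts ?G"
    then have "X \<lesssim> nat_game (c div 2)"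
      using left(2) IH(2) game_le_trans by blast
    then show "\<exists>X'. X' |\<in>| left_opts (nat_game (Suc (c div 2))) \<and> X \<lesssim> X'" by simp
  qed simp
  ultimately show ?case by (simp add: game_eq_def del: replicate_Suc)
qed (use left_opts_single[of 0] right_opts_ones[of 0] right_opts_ones[of 1] in
  \<open>auto simp: game_eq_def left_opts_coins_iff intro!: game_leI\<close>)

text \<open>Write \<open>n\<close> for \<open>a div 2\<close>. For positive \<open>k\<close> the
  best Left option has value \<open>n\<close>, and the best Right option is the case
  \<open>k - 1\<close>, of value \<open>n + 1 / 2^(k-1)\<close>; these are the options in the
  canonical form of \<open>n + 1 / 2^k\<close>. For \<open>k = 0\<close> the string is a block of
  \<open>a + 2\<close> ones.\<close>

lemma base_sound:
  "2 * p + q = k \<Longrightarrow>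
    same_right_opts (dyadic (int (a div 2) * 2 ^ k + 1) k)
      (coins_game (ones a @ zeros p @ One # zeros q @ [One])) \<and>
    dyadic (int (a div 2) * 2 ^ k + 1) k \<approx> coins_game (ones a @ zeros p @ One # zeros q @ [One])"
proof (induction k arbitrary: p q)
  case 0
  then have "ones a @ zeros p @ One # zeros q @ [One] = ones (Suc (Suc a))"
    by (simp add: replicate_append_same replicate_app_Cons_same)
  moreover have "dyadic (int (a div 2) * 2 ^ 0 + 1) 0 = nat_game (Suc (Suc a) div 2)"
    by (simp add: nat_add_distrib flip: Suc_eq_plus1)
  ultimately show ?case
    using ones_sound[of "Suc (Suc a)"] right_opts_ones[of "Suc (Suc a)"] right_opts_nat_game
    by (simp add: same_right_opts_def del: replicate_Suc replicate.simps)
next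
  case (Suc k)
  let ?G = "ones a @ zeros p @ One # zeros q @ [One]"
  obtain p' q' where pq': "2 * p' + q' = k"
    and mem: "coins_game (ones a @ zeros p' @ One # zeros q' @ [One]) |\<in>| right_opts (coins_game ?G)"
    and best: "\<And>Y. Y |\<in>| right_opts (coins_game ?G) \<Longrightarrow>
      coins_game (ones a @ zeros p' @ One # zeros q' @ [One]) \<lesssim> Y"
    using shift_last_pair[OF Suc.prems, of "ones a"] by blast
  let ?R = "ones a @ zeros p' @ One # zeros q' @ [One]" and ?n = "a div 2"
  let ?v = "dyadic (int ?n * 2 ^ Suc k + 1) (Suc k)" and ?v' = "dyadic (int ?n * 2 ^ k + 1) k"
  have v: "?v = Game {|nat_game ?n|} {|?v'|}"
  proof -
    \<comment> \<open>The numerator is odd; its even neighbours halve to \<open>n * 2^k\<close>,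
      which stands for the integer \<open>n\<close>, and to the numerator of
      \<open>?v'\<close>.\<close>
    have "int ?n * 2 ^ Suc k div 2 = int ?n * 2 ^ k" "(int ?n * 2 ^ Suc k + 2) div 2 = int ?n * 2 ^ k + 1"
      by simp_all
    then show ?thesis by (simp add: add.commute)
  qed
  have IH: "?v' \<approx> coins_game ?R" using Suc.IH[OF pq'] by blast
  have same: "same_right_opts ?v (coins_game ?G)"
    unfolding v using IH mem best game_le_trans by (auto simp: same_right_opts_def game_eq_def)
  have n: "nat_game ?n \<approx> coins_game (ones a @ zeros p)"
    using ones_sound[of a] by simp
  have left: "coins_game (ones a @ zeros p) |\<in>| left_opts (coins_game ?G)"
    "\<And>X. X |\<in>| left_opts (coins_game ?G) \<Longrightarrow> X \<lesssim> coins_game (ones a @ zeros p)"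
    using best_left_mem[of "ones a @ zeros p" q] best_left[of _ "ones a @ zeros p" q] by simp_all
  have "?v \<approx> coins_game ?G"
    unfolding v by (rule game_eq_best[OF _ _ left(2,1) n _ _ best mem IH]) simp_all
  with same show ?case by simp
qed

lemma evaluates_sound:
  "evaluates s v \<Longrightarrow> same_right_opts v (coins_game s) \<and> v \<approx> coins_game s"
proof (induction rule: evaluates.induct)
  case (evaluates_single r)
  have "dyadic (- int r) 0 = neg_nat_game r"
    by (cases r) (simp_all del: of_nat_Suc neg_nat_game.simps(2))
  then show ?case using single_sound[of r] by simp
next
  case (evaluates_base a p q)
  then show ?case using base_sound[OF refl] by simp
next
  case (evaluates_step s \<alpha> a p q v)
  then obtain b where "a = Suc b" by (cases a) auto
  moreover obtain k where "2 * p + q = Suc k"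
    using evaluates_step by (cases "2 * p + q") auto
  ultimately show ?case
    using ordinal_sum_sound[of v \<alpha> b p q k] evaluates_step by simp
qed

section \<open>Existence of a result\<close>

lemma position_trim: "position (trim s)"
proof (cases "dropWhile (\<lambda>d. d = Zero) (rev s)")
  case (Cons d ds)
  then show ?thesis
    using hd_dropWhile[of "\<lambda>d. d = Zero" "rev s"] by (auto simp: position_def trim_def)
qed (simp add: position_def trim_def del: dropWhile_eq_Nil_conv)

lemma count_list_trim: "count_list (trim s) One = count_list s One"
proof -
  obtain n where "s = trim s @ zeros n" by (rule trim_zeros)
  then have "count_list s One = count_list (trim s) One + count_list (zeros n) One"
    by (metis count_list_append)
  moreover have "count_list (zeros n) One = 0" by (induction n) auto
  ultimately show ?thesis by simp
qed

text \<open>Three coins are replaced by one. The falling count makes the reductions terminate, and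
  the remaining coin keeps the position nonempty.\<close>

lemma reduct_count: "reduct s t \<Longrightarrow> 0 < count_list t One \<and> count_list t One < count_list s One"
  by (induction rule: reduct.induct) (auto simp: count_list_trim numeral_3_eq_3)

lemma reduct_position: "reduct s t \<Longrightarrow> position s \<Longrightarrow> position t"
proof (induction rule: reduct.induct)
  case (reduct_a j \<alpha> \<beta>)
  then show ?case by (cases "\<beta> = []") (auto simp: position_def)
qed (rule position_trim)

lemma ex_reduced:
  assumes "position s" "s \<noteq> []"
  shows "\<exists>t. reduct\<^sup>*\<^sup>* s t \<and> reduced t \<and> position t \<and> t \<noteq> []"
  using assms
proof (induction "count_list s One" arbitrary: s rule: less_induct)
  case less
  show ?case
  proof (cases "reduced s")
    case True
    then show ?thesis using less.prems by blast
  next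
    case False
    then obtain t where t: "reduct s t" by (auto simp: reduced_def)
    then have "t \<noteq> []" "count_list t One < count_list s One" "position t"
      using reduct_count[OF t] reduct_position less.prems by auto
    then obtain u where "reduct\<^sup>*\<^sup>* t u \<and> reduced u \<and> position u \<and> u \<noteq> []"
      using less.hyps by blast
    then show ?thesis
      using t by (blast intro: converse_rtranclp_into_rtranclp)
  qed
qed

text \<open>A reduction of the prefix would extend to the whole string: rule (a) allows any tail,
  and an even number of further ones preserves the parity in rule (b). Step 3 cuts off two coins, so
  reducedness passes to the next string.\<close>

lemma reduced_prefix:
  assumes "reduced (s @ \<beta>')" "even (count_list \<beta>' One)"
  shows "reduced s"
  unfolding reduced_def
proof
  assume "\<exists>t. reduct s t"
  then obtain t where "reduct s t" by blast
  then show False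
  proof cases
    case (reduct_a j \<alpha> \<beta>)
    then show False
      using assms(1) reduct.reduct_a[of j \<alpha> "\<beta> @ \<beta>'"] by (simp add: reduced_def)
  next
    case (reduct_b \<beta> \<alpha>)
    then show False
      using assms reduct.reduct_b[of "\<beta> @ \<beta>'" \<alpha>] by (simp add: reduced_def)
  qed
qed

text \<open>Rule (b) with empty tail applies to exactly three final ones, rule (a) to more.\<close>

lemma not_reduced_last_ones: "\<not> reduced (\<alpha> @ Zero # ones (Suc (Suc (Suc b))))"
proof (cases b)
  case 0
  then show ?thesis
    using reduct_b[of "[]" \<alpha>] by (auto simp: reduced_def numeral_3_eq_3)
next
  case (Suc c)
  then show ?thesis
    using reduct_a[of b \<alpha> "[]"] by (auto simp: reduced_def numeral_3_eq_3)
qed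

text \<open>The last two coins determine \<open>p\<close> and \<open>q\<close>; with fewer than two
  further symbols of interest before them a base rule applies. Otherwise the block of ones ending in
  the third coin from the right decides: it reaches the start of the string, or a zero precedes it
  and the recursion continues with a shorter reduced string.\<close>

lemma ex_evaluates: "reduced s \<Longrightarrow> position s \<Longrightarrow> s \<noteq> [] \<Longrightarrow> \<exists>v. evaluates s v"
proof (induction "length s" arbitrary: s rule: less_induct)
  case less
  obtain t where s: "s = t @ [One]"
    using less.prems by (cases s rule: rev_cases) (auto simp: position_def)
  show ?case
  proof (cases rule: zeros_or_last_One[of t])
    case (1 r)
    then show ?thesis using s evaluates_single by blast
  next
    case (2 u q)
    have base: ?thesis if "u = ones a @ zeros p" for a p
      using evaluates_base[of a p q] s 2 that by auto
    show ?thesis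
    proof (cases rule: zeros_or_last_One[of u])
      case (1 p)
      then show ?thesis using base[of 0 p] by simp
    next
      case u: (2 w p)
      show ?thesis
      proof (cases rule: ones_or_last_Zero[of w])
        case (1 a)
        then show ?thesis using base[of "Suc a" p] u by (simp add: replicate_app_Cons_same)
      next
        case w: (2 \<alpha> b)
        let ?H = "\<alpha> @ Zero # ones (Suc b)"
        have s_eq: "s = ?H @ zeros p @ One # zeros q @ [One]"
          using s 2 u w by (simp add: replicate_app_Cons_same)
        have "count_list (zeros n) One = 0" for n by (induction n) auto
        then have "reduced ?H"
          using less.prems(1) s_eq by (intro reduced_prefix[of ?H "zeros p @ One # zeros q @ [One]"]) simp_all
        moreover have "position ?H" by (simp add: position_def)
        moreover have "length ?H < length s" by (simp add: s_eq)
        ultimately obtain v where "evaluates ?H v"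
          using less.hyps[of ?H] by auto
        \<comment> \<open>If \<open>p = q = 0\<close>, the two coins would prolong the block to at
          least three final ones after a zero, contrary to reducedness.\<close>
        moreover have "p + q \<ge> 1"
        proof (rule ccontr)
          assume "\<not> p + q \<ge> 1"
          then have "p = 0" "q = 0" by auto
          then have "s = \<alpha> @ Zero # ones (Suc (Suc (Suc b)))"
            by (simp add: s_eq replicate_append_same replicate_app_Cons_same)
          then show False using less.prems(1) not_reduced_last_ones by simp
        qed
        moreover have ?thesis if "base_string s"
          using that evaluates_single evaluates_base unfolding base_string_def by blast
        ultimately show ?thesis
          using evaluates_step[of s \<alpha> "Suc b" p q v] s_eq by auto
      qed
    qed
  qed
qed

theorem theorem3p3:
  fixes G :: "bool list"
  assumes "position G"
  shows "(G \<noteq> [] \<longrightarrow> (\<exists>v\<^sub>0. algorithm_returns G v\<^sub>0)) \<and>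
         (\<forall>v\<^sub>0. algorithm_returns G v\<^sub>0 \<longrightarrow> coins_game G \<approx> v\<^sub>0)"
proof (intro conjI impI allI)
  assume "G \<noteq> []"
  then show "\<exists>v\<^sub>0. algorithm_returns G v\<^sub>0"
    using ex_reduced[OF assms] ex_evaluates unfolding algorithm_returns_def by blast
next
  fix v\<^sub>0 assume "algorithm_returns G v\<^sub>0"
  then obtain G\<^sub>0 where "reduct\<^sup>*\<^sup>* G G\<^sub>0" "evaluates G\<^sub>0 v\<^sub>0"
    unfolding algorithm_returns_def by blast
  then show "coins_game G \<approx> v\<^sub>0"
    using reduct_rtranclp_sound evaluates_sound game_eq_trans game_eq_sym by blast
qed

end
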